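(* Let $(A,C)_\psi$ be an entwining structure over a field $k$. For all cohomology classes $\xi\in H^m_\psi(A)$ and $\eta\in H^n_\psi(A)$, $$\xi\cup\eta=(-1)^{mn}\,\eta\sqcup\xi .$$
   Context: $k$ is a field, $\otimes=\otimes_k$; algebras are associative and unital, coalgebras are coassociative and counital; $\mathrm{Hom}$ means $k$-linear maps; $V^n=V^{\otimes n}$ (with $V^0=k$); $\Delta(c)=c_{(1)}\otimes c_{(2)}$ and $\epsilon$ are the coproduct and counit of $C$. An entwining structure $(A,C)_\psi$ consists of an algebra $A$, a coalgebra $C$ and a $k$-linear map $\psi:C\otimes A\to A\otimes C$, written $\psi(c\otimes a)=a_\alpha\otimes c^\alpha$ (summation understood; repeated application uses further Greek indices), such that for all $a,a'\in A$, $c\in C$: $(aa')_\alpha\otimes c^\alpha=a_\alpha a'_\beta\otimes c^{\alpha\beta}$; $1_\alpha\otimes c^\alpha=1\otimes c$; $a_\alpha\otimes (c^\alpha)_{(1)}\otimes (c^\alpha)_{(2)}=a_{\beta\alpha}\otimes c_{(1)}{}^\alpha\otimes c_{(2)}{}^\beta$; $a_\alpha\epsilon(c^\alpha)=a\epsilon(c)$. $C_\psi(A)$ is the cochain complex with $C^n_\psi(A)=\mathrm{Hom}(C\otimes A^n,A)$, $n\ge0$, and $$df(c,a^1,\ldots,a^{n+1})=a^1_\alpha f(c^\alpha,a^2,\ldots,a^{n+1})+\sum_{i=1}^n(-1)^if(c,a^1,\ldots,a^ia^{i+1},\ldots,a^{n+1})+(-1)^{n+1}f(c,a^1,\ldots,a^n)a^{n+1}.$$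 Its cohomology is $H^\bullet_\psi(A)$. For $f\in C^m_\psi(A)$, $g\in C^n_\psi(A)$ define $f\cup g,\ f\sqcup g\in C^{m+n}_\psi(A)$ by $$(f\cup g)(c,a^1,\ldots,a^{m+n})=f(c_{(1)},a^1_{\alpha_1},\ldots,a^m_{\alpha_m})\,g(c_{(2)}{}^{\alpha_1\ldots\alpha_m},a^{m+1},\ldots,a^{m+n}),$$ $$(f\sqcup g)(c,a^1,\ldots,a^{m+n})=f(c_{(2)},a^1,\ldots,a^m)_\alpha\, g(c_{(1)}{}^\alpha,a^{m+1},\ldots,a^{m+n}).$$ The map $d$ is a degree one (graded) derivation for both products, so both descend to products on $H_\psi(A)$, denoted by the same symbols. *)

theory Defs
  imports Complex_Main "HOL-Library.Poly_Mapping"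
begin

section \<open>Tensor products\<close>

text \<open>
  The tensor product of vector spaces is the quotient of the free vector space on tuples, here the
  finitely supported functions \<open>'i \<Rightarrow>\<^sub>0 'k\<close>, by the span of the multilinearity relations. Since the
  scalar multiplications are not part of the types, this quotient cannot be a type of its own: a
  tensor is a coset, i.e. a value of type \<open>('i \<Rightarrow>\<^sub>0 'k) set\<close>.
\<close>

definition fscale :: "'k::field \<Rightarrow> ('i \<Rightarrow>\<^sub>0 'k) \<Rightarrow> ('i \<Rightarrow>\<^sub>0 'k)" where
  "fscale r p = Poly_Mapping.map ((*) r) p"

lemma lookup_fscale: "Poly_Mapping.lookup (fscale r p) i = r * Poly_Mapping.lookup p i"
  by (auto simp: fscale_def Poly_Mapping.map.rep_eq when_def)

lemma vector_space_fscale: "vector_space fscale"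
  by unfold_locales (auto intro!: poly_mapping_eqI simp: lookup_fscale lookup_add algebra_simps)

abbreviation gen :: "'i \<Rightarrow> ('i \<Rightarrow>\<^sub>0 'k::field)" where
  "gen i \<equiv> Poly_Mapping.single i 1"

text \<open>
  The relations making \<open>gen \<circ> j\<close> linear, where \<open>j\<close> inserts a vector into one slot of a tuple whose
  other entries are fixed.
\<close>
definition linear_rels ::
    "('k::field \<Rightarrow> 'v::ab_group_add \<Rightarrow> 'v) \<Rightarrow> ('v \<Rightarrow> 'i) \<Rightarrow> ('i \<Rightarrow>\<^sub>0 'k) set" where
  "linear_rels s j =
     {gen (j (u + v)) - gen (j u) - gen (j v) | u v. True} \<union>
     {gen (j (s r u)) - fscale r (gen (j u)) | r u. True}"

definition tensor2_ker ::
    "('k::field \<Rightarrow> 'x::ab_group_add \<Rightarrow> 'x) \<Rightarrow> ('k \<Rightarrow> 'y::ab_group_add \<Rightarrow> 'y)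
     \<Rightarrow> ('x \<times> 'y \<Rightarrow>\<^sub>0 'k) set" where
  "tensor2_ker sx sy = module.span fscale
     ((\<Union>y. linear_rels sx (\<lambda>x. (x, y))) \<union> (\<Union>x. linear_rels sy (\<lambda>y. (x, y))))"

definition tensor3_ker ::
    "('k::field \<Rightarrow> 'x::ab_group_add \<Rightarrow> 'x) \<Rightarrow> ('k \<Rightarrow> 'y::ab_group_add \<Rightarrow> 'y)
     \<Rightarrow> ('k \<Rightarrow> 'z::ab_group_add \<Rightarrow> 'z) \<Rightarrow> ('x \<times> 'y \<times> 'z \<Rightarrow>\<^sub>0 'k) set" where
  "tensor3_ker sx sy sz = module.span fscale
     ((\<Union>y z. linear_rels sx (\<lambda>x. (x, y, z))) \<union>
      (\<Union>x z. linear_rels sy (\<lambda>y. (x, y, z))) \<union>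
      (\<Union>x y. linear_rels sz (\<lambda>z. (x, y, z))))"

definition coset :: "('i \<Rightarrow>\<^sub>0 'k::field) set \<Rightarrow> ('i \<Rightarrow>\<^sub>0 'k) \<Rightarrow> ('i \<Rightarrow>\<^sub>0 'k) set" where
  "coset K p = {q. q - p \<in> K}"

abbreviation tensor2 where "tensor2 sx sy p \<equiv> coset (tensor2_ker sx sy) p"
abbreviation tensor3 where "tensor3 sx sy sz p \<equiv> coset (tensor3_ker sx sy sz) p"

definition linear_to_quotient ::
    "('k::field \<Rightarrow> 'v::ab_group_add \<Rightarrow> 'v) \<Rightarrow> ('i \<Rightarrow>\<^sub>0 'k) set \<Rightarrow> ('v \<Rightarrow> ('i \<Rightarrow>\<^sub>0 'k) set) \<Rightarrow> bool" where
  "linear_to_quotient s K h \<longleftrightarrow>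
     (\<forall>u. h u \<in> range (coset K)) \<and>
     (\<forall>u v. \<forall>p\<in>h u. \<forall>q\<in>h v. h (u + v) = coset K (p + q)) \<and>
     (\<forall>r u. \<forall>p\<in>h u. h (s r u) = coset K (fscale r p))"

text \<open>
  For a tensor \<open>T = \<Sum>\<^sub>i x\<^sub>i \<otimes> y\<^sub>i\<close> and a bilinear map \<open>\<beta>\<close> with values in a space with scalar
  multiplication \<open>s\<close>, \<open>sweedler s T \<beta>\<close> is \<open>\<Sum>\<^sub>i \<beta> (x\<^sub>i, y\<^sub>i)\<close>, the linear map induced by \<open>\<beta>\<close> on the
  tensor product. It is computed from a chosen representative, which is immaterial for bilinear
  \<open>\<beta>\<close> (or, if values are in a free space, for \<open>\<beta>\<close> that is bilinear modulo the relations there).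
\<close>
definition sweedler ::
    "('k::field \<Rightarrow> 'v::ab_group_add \<Rightarrow> 'v) \<Rightarrow> ('i \<Rightarrow>\<^sub>0 'k) set \<Rightarrow> ('i \<Rightarrow> 'v) \<Rightarrow> 'v" where
  "sweedler s T \<beta> =
     (let p = (SOME p. p \<in> T)
      in \<Sum>i\<in>Poly_Mapping.keys p. s (Poly_Mapping.lookup p i) (\<beta> i))"


section \<open>Algebras, coalgebras, entwining structures\<close>

text \<open>The sort \<open>{ring, monoid_mult}\<close> is \<open>ring_1\<close> without \<open>0 \<noteq> 1\<close>, so the zero algebra is allowed.\<close>
locale k_algebra = vector_space scale
  for scale :: "'k::field \<Rightarrow> 'a::{ring,monoid_mult} \<Rightarrow> 'a" +
  assumes scale_mult_left: "scale r x * y = scale r (x * y)"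
    and scale_mult_right: "x * scale r y = scale r (x * y)"

locale k_coalgebra = vector_space scale
  for scale :: "'k::field \<Rightarrow> 'c::ab_group_add \<Rightarrow> 'c" +
  fixes \<Delta> :: "'c \<Rightarrow> ('c \<times> 'c \<Rightarrow>\<^sub>0 'k) set"
    and \<epsilon> :: "'c \<Rightarrow> 'k"
  assumes linear_comult: "linear_to_quotient scale (tensor2_ker scale scale) \<Delta>"
    and linear_counit: "Vector_Spaces.linear scale (*) \<epsilon>"
    and coassoc:
      "tensor3 scale scale scale
         (sweedler fscale (\<Delta> c) (\<lambda>(x, y). sweedler fscale (\<Delta> x) (\<lambda>(u, v). gen (u, v, y))))
     = tensor3 scale scale scale
         (sweedler fscale (\<Delta> c) (\<lambda>(x, y). sweedler fscale (\<Delta> y) (\<lambda>(u, v). gen (x, u, v))))"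
    and counit_left: "sweedler scale (\<Delta> c) (\<lambda>(x, y). scale (\<epsilon> x) y) = c"
    and counit_right: "sweedler scale (\<Delta> c) (\<lambda>(x, y). scale (\<epsilon> y) x) = c"

text \<open>A linear map out of \<open>C \<otimes> A\<close> is given as a bilinear map; \<open>\<psi> c a\<close> stands for \<open>\<psi>(c \<otimes> a) \<in> A \<otimes> C\<close>.\<close>
locale entwining_structure =
  A: k_algebra sA + C: k_coalgebra sC \<Delta> \<epsilon>
  for sA :: "'k::field \<Rightarrow> 'a::{ring,monoid_mult} \<Rightarrow> 'a"
    and sC :: "'k \<Rightarrow> 'c::ab_group_add \<Rightarrow> 'c"
    and \<Delta> :: "'c \<Rightarrow> ('c \<times> 'c \<Rightarrow>\<^sub>0 'k) set"
    and \<epsilon> :: "'c \<Rightarrow> 'k" +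
  fixes \<psi> :: "'c \<Rightarrow> 'a \<Rightarrow> ('a \<times> 'c \<Rightarrow>\<^sub>0 'k) set"
  assumes linear_entw_left: "linear_to_quotient sC (tensor2_ker sA sC) (\<lambda>c. \<psi> c a)"
    and linear_entw_right: "linear_to_quotient sA (tensor2_ker sA sC) (\<lambda>a. \<psi> c a)"
    and entw_mult:
      "\<psi> c (a * a') = tensor2 sA sC
         (sweedler fscale (\<psi> c a) (\<lambda>(x, d). sweedler fscale (\<psi> d a') (\<lambda>(y, e). gen (x * y, e))))"
    and entw_one: "\<psi> c 1 = tensor2 sA sC (gen (1, c))"
    and entw_comult:
      "tensor3 sA sC sC
         (sweedler fscale (\<psi> c a) (\<lambda>(x, d). sweedler fscale (\<Delta> d) (\<lambda>(d1, d2). gen (x, d1, d2))))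
     = tensor3 sA sC sC
         (sweedler fscale (\<Delta> c) (\<lambda>(c1, c2). sweedler fscale (\<psi> c2 a) (\<lambda>(x, e2).
            sweedler fscale (\<psi> c1 x) (\<lambda>(y, e1). gen (y, e1, e2)))))"
    and entw_counit: "sweedler sA (\<psi> c a) (\<lambda>(x, d). sA (\<epsilon> d) x) = sA (\<epsilon> c) a"
begin

section \<open>The cochain complex and its products\<close>

text \<open>
  Linear maps \<open>C \<otimes> A\<^sup>n \<rightarrow> A\<close> are given as multilinear maps \<open>f c [a\<^sup>1, \<dots>, a\<^sup>n]\<close>, set to \<open>0\<close> on lists of
  other lengths so that equality of cochains is equality of functions.
\<close>
definition cochains :: "nat \<Rightarrow> ('c \<Rightarrow> 'a list \<Rightarrow> 'a) set" where
  "cochains n = {f.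
     (\<forall>c as. length as \<noteq> n \<longrightarrow> f c as = 0) \<and>
     (\<forall>as. length as = n \<longrightarrow> Vector_Spaces.linear sC sA (\<lambda>c. f c as)) \<and>
     (\<forall>c as i. length as = n \<longrightarrow> i < n \<longrightarrow> Vector_Spaces.linear sA sA (\<lambda>x. f c (as[i := x])))}"

text \<open>List positions count from 0: \<open>as ! (i - 1)\<close> is \<open>a\<^sup>i\<close>.\<close>
definition differential :: "nat \<Rightarrow> ('c \<Rightarrow> 'a list \<Rightarrow> 'a) \<Rightarrow> 'c \<Rightarrow> 'a list \<Rightarrow> 'a" where
  "differential n f c as = (if length as = n + 1 then
       sweedler sA (\<psi> c (hd as)) (\<lambda>(x, e). x * f e (tl as))
     + (\<Sum>i = 1..n. (-1) ^ i * f c (take (i - 1) as @ [as ! (i - 1) * as ! i] @ drop (i + 1) as))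
     + (-1) ^ (n + 1) * (f c (butlast as) * last as)
   else 0)"

text \<open>\<open>entwine [a\<^sup>1, \<dots>, a\<^sup>m] c F\<close> is \<open>F [a\<^sup>1\<^sub>\<alpha>\<^sub>1, \<dots>, a\<^sup>m\<^sub>\<alpha>\<^sub>m] c\<^bsup>\<alpha>\<^sub>1\<dots>\<alpha>\<^sub>m\<^esup>\<close>, summation understood.\<close>
primrec entwine :: "'a list \<Rightarrow> 'c \<Rightarrow> ('a list \<Rightarrow> 'c \<Rightarrow> 'a) \<Rightarrow> 'a" where
  "entwine [] c F = F [] c"
| "entwine (a # as) c F =
     sweedler sA (\<psi> c a) (\<lambda>(x, e). entwine as e (\<lambda>bs e'. F (x # bs) e'))"

definition cup ::
    "nat \<Rightarrow> nat \<Rightarrow> ('c \<Rightarrow> 'a list \<Rightarrow> 'a) \<Rightarrow> ('c \<Rightarrow> 'a list \<Rightarrow> 'a) \<Rightarrow> 'c \<Rightarrow> 'a list \<Rightarrow> 'a" where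
  "cup m n f g c as = (if length as = m + n then
     sweedler sA (\<Delta> c) (\<lambda>(c1, c2).
       entwine (take m as) c2 (\<lambda>bs e. f c1 bs * g e (drop m as)))
   else 0)"

definition sqcup ::
    "nat \<Rightarrow> nat \<Rightarrow> ('c \<Rightarrow> 'a list \<Rightarrow> 'a) \<Rightarrow> ('c \<Rightarrow> 'a list \<Rightarrow> 'a) \<Rightarrow> 'c \<Rightarrow> 'a list \<Rightarrow> 'a" where
  "sqcup m n f g c as = (if length as = m + n then
     sweedler sA (\<Delta> c) (\<lambda>(c1, c2).
       sweedler sA (\<psi> c1 (f c2 (take m as))) (\<lambda>(x, e). x * g e (drop m as)))
   else 0)"


section \<open>Cohomology\<close>

definition cocycles :: "nat \<Rightarrow> ('c \<Rightarrow> 'a list \<Rightarrow> 'a) set" where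
  "cocycles n = {f \<in> cochains n. differential n f = (\<lambda>c as. 0)}"

definition coboundaries :: "nat \<Rightarrow> ('c \<Rightarrow> 'a list \<Rightarrow> 'a) set" where
  "coboundaries n = (case n of 0 \<Rightarrow> {\<lambda>c as. 0} | Suc k \<Rightarrow> differential k ` cochains k)"

definition cohomologous :: "nat \<Rightarrow> (('c \<Rightarrow> 'a list \<Rightarrow> 'a) \<times> ('c \<Rightarrow> 'a list \<Rightarrow> 'a)) set" where
  "cohomologous n = {(f, g). f \<in> cocycles n \<and> g \<in> cocycles n \<and>
     (\<lambda>c as. f c as - g c as) \<in> coboundaries n}"

definition cohomology :: "nat \<Rightarrow> ('c \<Rightarrow> 'a list \<Rightarrow> 'a) set set" where
  "cohomology n = cocycles n // cohomologous n"

text \<open>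
  Operations on classes: the unions range over all representatives, and are a single class because
  the operations on cocycles respect the relation of being cohomologous.
\<close>
definition coh_cup ::
    "nat \<Rightarrow> nat \<Rightarrow> ('c \<Rightarrow> 'a list \<Rightarrow> 'a) set \<Rightarrow> ('c \<Rightarrow> 'a list \<Rightarrow> 'a) set
     \<Rightarrow> ('c \<Rightarrow> 'a list \<Rightarrow> 'a) set" where
  "coh_cup m n \<xi> \<eta> = (\<Union>f\<in>\<xi>. \<Union>g\<in>\<eta>. cohomologous (m + n) `` {cup m n f g})"

definition coh_sqcup ::
    "nat \<Rightarrow> nat \<Rightarrow> ('c \<Rightarrow> 'a list \<Rightarrow> 'a) set \<Rightarrow> ('c \<Rightarrow> 'a list \<Rightarrow> 'a) set
     \<Rightarrow> ('c \<Rightarrow> 'a list \<Rightarrow> 'a) set" where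
  "coh_sqcup m n \<xi> \<eta> = (\<Union>f\<in>\<xi>. \<Union>g\<in>\<eta>. cohomologous (m + n) `` {sqcup m n f g})"

definition coh_scale :: "nat \<Rightarrow> 'k \<Rightarrow> ('c \<Rightarrow> 'a list \<Rightarrow> 'a) set \<Rightarrow> ('c \<Rightarrow> 'a list \<Rightarrow> 'a) set" where
  "coh_scale n r \<xi> = (\<Union>f\<in>\<xi>. cohomologous n `` {\<lambda>c as. sA r (f c as)})"

end

end

theory Submission
  imports Defs
begin

text \<open>
  As for the Gerstenhaber algebra of Hochschild cochains, the commutativity is witnessed by partial
  compositions: \<open>f \<circ>\<^sub>i g\<close> inserts \<open>g\<close>, evaluated at \<open>c\<^sub>(\<^sub>2\<^sub>)\<close> entwined through the first \<open>i\<close> arguments,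
  into slot \<open>i + 1\<close> of \<open>f(c\<^sub>(\<^sub>1\<^sub>), \<dots>)\<close>. For cocycles \<open>f\<close>, \<open>g\<close> of degrees \<open>m\<close>, \<open>n\<close>, insert \<open>g\<close> after
  the first \<open>i\<close> arguments of \<open>df = 0\<close> and cut the terms at the inserted entry, so that
  \<open>L\<^sub>i + R\<^sub>i = 0\<close>, where \<open>L\<^sub>i\<close> collects the terms of \<open>df\<close> that act to the left of that entry
  and \<open>R\<^sub>i\<close> those that act to its right. Since \<open>dg = 0\<close>, one finds
  \<open>d(f \<circ>\<^sub>i g) = L\<^sub>i\<^sub>+\<^sub>1 + (-1)\<^sup>n\<^sup>+\<^sup>1 R\<^sub>i = L\<^sub>i\<^sub>+\<^sub>1 - (-1)\<^sup>n\<^sup>+\<^sup>1 L\<^sub>i\<close>. Hence \<open>L\<^sub>m\<close> is cohomologous to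
  \<open>(-1)\<^bsup>m(n+1)\<^esup> L\<^sub>0\<close>, and \<open>L\<^sub>0 = g \<squnion> f\<close>, \<open>L\<^sub>m = (-1)\<^sup>m f \<union> g\<close>.
\<close>

section \<open>Linear maps out of tensor products\<close>

text \<open>Unlike \<open>Vector_Spaces.linear\<close>, this does not carry the vector space axioms of \<open>s\<close> and \<open>t\<close>.\<close>
definition lin_on ::
    "('k::field \<Rightarrow> 'v::ab_group_add \<Rightarrow> 'v) \<Rightarrow> ('k \<Rightarrow> 'w::ab_group_add \<Rightarrow> 'w) \<Rightarrow> ('v \<Rightarrow> 'w) \<Rightarrow> bool" where
  "lin_on s t f \<longleftrightarrow> (\<forall>x y. f (x + y) = f x + f y) \<and> (\<forall>r x. f (s r x) = t r (f x))"

lemma lin_onI: "(\<And>x y. f (x + y) = f x + f y) \<Longrightarrow> (\<And>r x. f (s r x) = t r (f x)) \<Longrightarrow> lin_on s t f"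
  by (simp add: lin_on_def)

lemma lin_on_add: "lin_on s t f \<Longrightarrow> f (x + y) = f x + f y"
  by (simp add: lin_on_def)

lemma lin_on_scale: "lin_on s t f \<Longrightarrow> f (s r x) = t r (f x)"
  by (simp add: lin_on_def)

lemma lin_on_zero: "lin_on s t f \<Longrightarrow> f 0 = 0"
  by (metis add_cancel_right_left lin_on_add)

lemma lin_on_minus: "lin_on s t f \<Longrightarrow> f (- x) = - f x"
  by (metis add.right_inverse add_eq_0_iff lin_on_add lin_on_zero)

lemma lin_on_diff: "lin_on s t f \<Longrightarrow> f (x - y) = f x - f y"
  using lin_on_add[of s t f x "- y"] by (simp add: lin_on_minus)

lemma lin_on_sum: "lin_on s t f \<Longrightarrow> f (sum h A) = (\<Sum>x\<in>A. f (h x))"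
  by (induction A rule: infinite_finite_induct) (simp_all add: lin_on_zero lin_on_add)

lemma lin_on_id: "lin_on s s (\<lambda>x. x)"
  by (simp add: lin_on_def)

lemma lin_on_comp: "lin_on t u g \<Longrightarrow> lin_on s t f \<Longrightarrow> lin_on s u (\<lambda>x. g (f x))"
  by (simp add: lin_on_def)

lemma linear_eq_lin_on: "vector_space s \<Longrightarrow> vector_space t \<Longrightarrow> Vector_Spaces.linear s t f \<longleftrightarrow> lin_on s t f"
  by (auto simp: lin_on_def Vector_Spaces.linear_iff)

definition bilin_on ::
    "('k::field \<Rightarrow> 'x::ab_group_add \<Rightarrow> 'x) \<Rightarrow> ('k \<Rightarrow> 'y::ab_group_add \<Rightarrow> 'y)
     \<Rightarrow> ('k \<Rightarrow> 'v::ab_group_add \<Rightarrow> 'v) \<Rightarrow> ('x \<Rightarrow> 'y \<Rightarrow> 'v) \<Rightarrow> bool" where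
  "bilin_on sx sy t \<beta> \<longleftrightarrow> (\<forall>y. lin_on sx t (\<lambda>x. \<beta> x y)) \<and> (\<forall>x. lin_on sy t (\<beta> x))"

lemma bilin_onI:
  "(\<And>y. lin_on sx t (\<lambda>x. \<beta> x y)) \<Longrightarrow> (\<And>x. lin_on sy t (\<beta> x)) \<Longrightarrow> bilin_on sx sy t \<beta>"
  by (simp add: bilin_on_def)

text \<open>The linear extension of \<open>\<beta>\<close> to the free vector space.
  \<open>sweedler\<close> is this map at the chosen representative of a coset; with the
  representative as an argument it is linear.\<close>

definition lin_ext ::
    "('k::field \<Rightarrow> 'v::ab_group_add \<Rightarrow> 'v) \<Rightarrow> ('i \<Rightarrow> 'v) \<Rightarrow> ('i \<Rightarrow>\<^sub>0 'k) \<Rightarrow> 'v" where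
  "lin_ext s \<beta> p = (\<Sum>i\<in>Poly_Mapping.keys p. s (Poly_Mapping.lookup p i) (\<beta> i))"

context vector_space
begin

text \<open>The supports of \<open>p + q\<close> and of a multiple may shrink by cancellation, so
  linearity is checked on sums over a common finite index set.\<close>

lemma lin_ext_superset:
  assumes "finite I" "Poly_Mapping.keys p \<subseteq> I"
  shows "lin_ext scale \<beta> p = (\<Sum>i\<in>I. scale (Poly_Mapping.lookup p i) (\<beta> i))"
  unfolding lin_ext_def using assms
  by (intro sum.mono_neutral_left) (auto simp: in_keys_iff)

lemma lin_on_lin_ext: "lin_on fscale scale (lin_ext scale \<beta>)"
proof (rule lin_onI)
  fix p q :: "'c \<Rightarrow>\<^sub>0 'a" and r
  let ?I = "Poly_Mapping.keys p \<union> Poly_Mapping.keys q"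
  have "Poly_Mapping.keys (p + q) \<subseteq> ?I" by (rule Poly_Mapping.keys_add)
  then show "lin_ext scale \<beta> (p + q) = lin_ext scale \<beta> p + lin_ext scale \<beta> q"
    by (simp add: lin_ext_superset[of ?I] lookup_add scale_left_distrib sum.distrib)
  have "Poly_Mapping.keys (fscale r p) \<subseteq> Poly_Mapping.keys p"
    by (auto simp: in_keys_iff lookup_fscale)
  then show "lin_ext scale \<beta> (fscale r p) = scale r (lin_ext scale \<beta> p)"
    by (simp add: lin_ext_superset[of "Poly_Mapping.keys p"] lookup_fscale scale_sum_right)
qed

lemma lin_ext_gen: "lin_ext scale \<beta> (gen i) = \<beta> i"
  by (simp add: lin_ext_def)

lemma sweedler_eq_lin_ext: "sweedler scale T \<beta> = lin_ext scale \<beta> (SOME p. p \<in> T)"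
  by (simp add: sweedler_def lin_ext_def Let_def)

lemma sweedler_add:
  "sweedler scale T (\<lambda>i. \<beta> i + \<gamma> i) = sweedler scale T \<beta> + sweedler scale T \<gamma>"
  by (simp add: sweedler_eq_lin_ext lin_ext_def scale_right_distrib sum.distrib)

lemma sweedler_scale: "sweedler scale T (\<lambda>i. scale r (\<beta> i)) = scale r (sweedler scale T \<beta>)"
  by (simp add: sweedler_eq_lin_ext lin_ext_def scale_sum_right mult.commute)

text \<open>The tensor \<open>T\<close> is fixed and so is its chosen representative; linearity in a
  parameter therefore passes through the finite sum termwise.\<close>

lemma lin_on_sweedler_fun:
  assumes "\<And>i. lin_on s scale (\<lambda>x. \<beta> x i)"
  shows "lin_on s scale (\<lambda>x. sweedler scale T (\<beta> x))"
proof (rule lin_onI)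
  fix x y r
  have "\<beta> (x + y) = (\<lambda>i. \<beta> x i + \<beta> y i)" "\<beta> (s r x) = (\<lambda>i. scale r (\<beta> x i))"
    using lin_on_add[OF assms] lin_on_scale[OF assms] by blast+
  then show "sweedler scale T (\<beta> (x + y)) = sweedler scale T (\<beta> x) + sweedler scale T (\<beta> y)"
    and "sweedler scale T (\<beta> (s r x)) = scale r (sweedler scale T (\<beta> x))"
    by (simp_all add: sweedler_add sweedler_scale)
qed

lemma sweedler_minus: "sweedler scale T (\<lambda>i. - \<beta> i) = - sweedler scale T \<beta>"
  by (simp add: sweedler_eq_lin_ext lin_ext_def sum_negf)

lemma sweedler_diff:
  "sweedler scale T (\<lambda>i. \<beta> i - \<gamma> i) = sweedler scale T \<beta> - sweedler scale T \<gamma>"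
  by (simp add: sweedler_eq_lin_ext lin_ext_def scale_right_diff_distrib sum_subtractf)

lemma sweedler_zero: "sweedler scale T (\<lambda>i. 0) = 0"
  by (simp add: sweedler_eq_lin_ext lin_ext_def)

lemma sweedler_swap:
  "sweedler scale T (\<lambda>i. sweedler scale U (\<gamma> i)) = sweedler scale U (\<lambda>j. sweedler scale T (\<lambda>i. \<gamma> i j))"
  unfolding sweedler_eq_lin_ext lin_ext_def
  by (subst scale_sum_right, subst sum.swap) (simp add: scale_sum_right mult.commute)

text \<open>Evaluates the nested formal sums in which the axioms are written: the linear map
  \<open>lin_ext\<close> passes through the outer sum.\<close>

lemma lin_ext_sweedler:
  "lin_ext scale \<gamma> (sweedler fscale T B) = sweedler scale T (\<lambda>i. lin_ext scale \<gamma> (B i))"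
proof -
  interpret F: vector_space "fscale :: 'a \<Rightarrow> _ \<Rightarrow> 'c \<Rightarrow>\<^sub>0 'a" by (rule vector_space_fscale)
  show ?thesis
    by (simp add: F.sweedler_eq_lin_ext sweedler_eq_lin_ext lin_ext_def[of _ B] lin_ext_def[of _ "\<lambda>i. lin_ext scale \<gamma> (B i)"]
      lin_on_sum[OF lin_on_lin_ext] lin_on_scale[OF lin_on_lin_ext])
qed

lemma lin_ext_span_zero:
  assumes "\<And>p. p \<in> R \<Longrightarrow> lin_ext scale \<beta> p = 0" "p \<in> module.span fscale R"
  shows "lin_ext scale \<beta> p = 0"
proof -
  interpret F: vector_space "fscale :: 'a \<Rightarrow> _ \<Rightarrow> 'c \<Rightarrow>\<^sub>0 'a" by (rule vector_space_fscale)
  have "F.subspace {p. lin_ext scale \<beta> p = 0}"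
    by (intro F.subspaceI)
      (auto simp: lin_on_zero[OF lin_on_lin_ext] lin_on_add[OF lin_on_lin_ext] lin_on_scale[OF lin_on_lin_ext])
  then show ?thesis
    using F.span_minimal[of R "{p. lin_ext scale \<beta> p = 0}"] assms by blast
qed

lemma lin_ext_linear_rels_zero:
  assumes "lin_on s scale (\<lambda>x. \<beta> (j x))" "p \<in> linear_rels s j"
  shows "lin_ext scale \<beta> p = 0"
  using assms unfolding linear_rels_def
  by (auto simp: lin_on_diff[OF lin_on_lin_ext] lin_on_scale[OF lin_on_lin_ext] lin_ext_gen
      lin_on_add[OF assms(1)] lin_on_scale[OF assms(1)])

lemma lin_ext_tensor2_ker:
  assumes "bilin_on sx sy scale \<beta>" "p \<in> tensor2_ker sx sy"
  shows "lin_ext scale (\<lambda>(x, y). \<beta> x y) p = 0"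
  by (rule lin_ext_span_zero[OF _ assms(2)[unfolded tensor2_ker_def]], elim UnE UN_E;
      rule lin_ext_linear_rels_zero[rotated], assumption)
    (use assms(1) in \<open>simp_all add: bilin_on_def\<close>)

lemma lin_ext_tensor3_ker:
  assumes "\<And>y z. lin_on sx scale (\<lambda>x. \<beta> x y z)" "\<And>x z. lin_on sy scale (\<lambda>y. \<beta> x y z)"
    "\<And>x y. lin_on sz scale (\<beta> x y)" "p \<in> tensor3_ker sx sy sz"
  shows "lin_ext scale (\<lambda>(x, y, z). \<beta> x y z) p = 0"
  by (rule lin_ext_span_zero[OF _ assms(4)[unfolded tensor3_ker_def]], elim UnE UN_E;
      rule lin_ext_linear_rels_zero[rotated], assumption)
    (simp_all add: assms(1-3))

lemma lin_ext_coset: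
  assumes "\<And>p. p \<in> K \<Longrightarrow> lin_ext scale \<beta> p = 0" "q \<in> coset K p"
  shows "lin_ext scale \<beta> q = lin_ext scale \<beta> p"
  using assms lin_on_diff[OF lin_on_lin_ext, of \<beta> q p] by (simp add: coset_def)

end

lemma self_in_coset_span: "p \<in> coset (module.span fscale R) p"
proof -
  interpret F: vector_space "fscale :: 'b \<Rightarrow> _ \<Rightarrow> 'a \<Rightarrow>\<^sub>0 'b" by (rule vector_space_fscale)
  show ?thesis by (simp add: coset_def F.span_zero)
qed

lemma self_in_tensor2: "p \<in> tensor2 sx sy p" and self_in_tensor3: "q \<in> tensor3 sx sy sz q"
  unfolding tensor2_ker_def tensor3_ker_def by (rule self_in_coset_span)+

context vector_space
begin

text \<open>Representatives of a tensor differ by a combination of the bilinearity relations, on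
  which the extension of a bilinear map vanishes; this is where the choice in
  \<open>sweedler\<close> becomes immaterial.\<close>

lemma sweedler_tensor2:
  assumes "bilin_on sx sy scale \<beta>"
  shows "sweedler scale (tensor2 sx sy p) (\<lambda>(x, y). \<beta> x y) = lin_ext scale (\<lambda>(x, y). \<beta> x y) p"
  unfolding sweedler_eq_lin_ext
  by (rule lin_ext_coset[OF lin_ext_tensor2_ker[OF assms]], assumption, rule someI, rule self_in_tensor2)

lemma tensor3_eq_imp_lin_ext_eq:
  assumes "tensor3 sx sy sz p = tensor3 sx sy sz q"
    and "\<And>y z. lin_on sx scale (\<lambda>x. \<beta> x y z)" "\<And>x z. lin_on sy scale (\<lambda>y. \<beta> x y z)"
    "\<And>x y. lin_on sz scale (\<beta> x y)"
  shows "lin_ext scale (\<lambda>(x, y, z). \<beta> x y z) p = lin_ext scale (\<lambda>(x, y, z). \<beta> x y z) q"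
  by (rule lin_ext_coset[OF lin_ext_tensor3_ker[OF assms(2-4)]], assumption)
    (metis assms(1) self_in_tensor3)

text \<open>Here the tensor itself varies, and the representatives chosen for
  \<open>h (u + v)\<close>, \<open>h u\<close> and \<open>h v\<close> are unrelated. Bilinearity of
  \<open>\<beta>\<close> permits replacing them by \<open>p + q\<close>, \<open>p\<close> and
  \<open>q\<close>.\<close>

lemma lin_on_sweedler_tensor:
  assumes "linear_to_quotient s (tensor2_ker sx sy) h" "bilin_on sx sy scale \<beta>"
  shows "lin_on s scale (\<lambda>u. sweedler scale (h u) (\<lambda>(x, y). \<beta> x y))"
proof (rule lin_onI)
  fix u v r
  obtain p q where pq: "h u = tensor2 sx sy p" "h v = tensor2 sx sy q"
    using assms(1) unfolding linear_to_quotient_def by (metis rangeE)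
  then have "p \<in> h u" "q \<in> h v" by (simp_all add: self_in_tensor2)
  then have "h (u + v) = tensor2 sx sy (p + q)" "h (s r u) = tensor2 sx sy (fscale r p)"
    using assms(1) unfolding linear_to_quotient_def by blast+
  then show "sweedler scale (h (u + v)) (\<lambda>(x, y). \<beta> x y)
      = sweedler scale (h u) (\<lambda>(x, y). \<beta> x y) + sweedler scale (h v) (\<lambda>(x, y). \<beta> x y)"
    and "sweedler scale (h (s r u)) (\<lambda>(x, y). \<beta> x y) = scale r (sweedler scale (h u) (\<lambda>(x, y). \<beta> x y))"
    by (simp_all add: pq sweedler_tensor2[OF assms(2)] lin_on_add[OF lin_on_lin_ext] lin_on_scale[OF lin_on_lin_ext])
qed

end

lemma lin_on_sweedler:
  assumes "vector_space s" "vector_space t" "lin_on s t \<phi>"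
  shows "\<phi> (sweedler s T \<beta>) = sweedler t T (\<lambda>i. \<phi> (\<beta> i))"
  by (simp add: assms(1,2)[THEN vector_space.sweedler_eq_lin_ext] lin_ext_def
      lin_on_sum[OF assms(3)] lin_on_scale[OF assms(3)])

section \<open>Entwining axioms under multilinear maps\<close>

context entwining_structure
begin

abbreviation LA where "LA \<equiv> lin_on sA sA"
abbreviation LC where "LC \<equiv> lin_on sC sA"

text \<open>A bilinear \<open>\<beta>\<close> factors through the tensor product, which turns the
  equation of cosets in \<open>entw_mult\<close> into an equation of values.\<close>

lemma entw_mult_sweedler:
  assumes "bilin_on sA sC sA \<beta>"
  shows "sweedler sA (\<psi> c (a * a')) (\<lambda>(x, e). \<beta> x e)
    = sweedler sA (\<psi> c a) (\<lambda>(x, d). sweedler sA (\<psi> d a') (\<lambda>(y, e). \<beta> (x * y) e))"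
  using A.sweedler_tensor2[OF assms, unfolded case_prod_unfold]
  by (simp add: entw_mult A.lin_ext_sweedler A.lin_ext_gen case_prod_unfold)

lemma entw_comult_sweedler:
  assumes "\<And>d e. LA (\<lambda>x. \<beta> x d e)" "\<And>x e. LC (\<lambda>d. \<beta> x d e)" "\<And>x d. LC (\<beta> x d)"
  shows "sweedler sA (\<psi> c a) (\<lambda>(x, d). sweedler sA (\<Delta> d) (\<lambda>(d1, d2). \<beta> x d1 d2))
    = sweedler sA (\<Delta> c) (\<lambda>(c1, c2). sweedler sA (\<psi> c2 a) (\<lambda>(x, e2).
            sweedler sA (\<psi> c1 x) (\<lambda>(y, e1). \<beta> y e1 e2)))"
  using A.tensor3_eq_imp_lin_ext_eq[OF entw_comult assms]
  by (simp add: A.lin_ext_sweedler A.lin_ext_gen case_prod_unfold)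

end

section \<open>Alternating sums over merged neighbours\<close>

text \<open>The sign (-1)^n in a form that makes sense in every abelian group; as a case distinction
  it reduces sign computations to parities.\<close>

definition alt :: "nat \<Rightarrow> 'v::ab_group_add \<Rightarrow> 'v" where
  "alt n x = (if even n then x else - x)"

lemma alt_alt: "alt m (alt n x) = alt (m + n) x"
  and alt_add: "alt n (x + y) = alt n x + alt n y"
  and alt_diff: "alt n (x - y) = alt n x - alt n y"
  by (simp_all add: alt_def)

lemma power_minus_one_mult: "(- 1) ^ n * x = alt n (x :: 'a::{ring,monoid_mult})"
  by (induction n) (simp_all add: alt_def mult.assoc)

text \<open>
  The inner terms of the Hochschild differential, in recursive form: the sum of
  \<open>(-1)\<^sup>i F [a\<^sup>1, \<dots>, a\<^sup>i a\<^sup>i\<^sup>+\<^sup>1, \<dots>]\<close>.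
\<close>
fun merge_sum :: "('a::semigroup_mult list \<Rightarrow> 'b::ab_group_add) \<Rightarrow> 'a list \<Rightarrow> 'b" where
  "merge_sum F (a # b # r) = - F (a * b # r) - merge_sum (\<lambda>l. F (a # l)) (b # r)"
| "merge_sum F [a] = 0"
| "merge_sum F [] = 0"

text \<open>Merging shortens the list by one, so only the values of \<open>F\<close> at that length
  enter.\<close>

lemma merge_sum_cong:
  "(\<And>l. Suc (length l) = length as \<Longrightarrow> F l = G l) \<Longrightarrow> merge_sum F as = merge_sum G as"
proof (induction F as arbitrary: G rule: merge_sum.induct)
  case (1 F a b r)
  have "merge_sum (\<lambda>l. F (a # l)) (b # r) = merge_sum (\<lambda>l. G (a # l)) (b # r)"
    by (rule "1.IH") (simp add: "1.prems")
  then show ?case by (simp add: "1.prems")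
qed simp_all

lemma merge_sum_add: "merge_sum (\<lambda>l. F l + G l) as = merge_sum F as + merge_sum G as"
  and merge_sum_minus: "merge_sum (\<lambda>l. - F l) as = - merge_sum F as"
  by (induction F as arbitrary: G rule: merge_sum.induct) simp_all

text \<open>The two sums share the entry \<open>a\<close>, so no merge is counted twice and none is lost.\<close>
lemma merge_sum_overlap:
  "merge_sum F (xs @ a # ys) =
     merge_sum (\<lambda>l. F (l @ ys)) (xs @ [a]) + alt (length xs) (merge_sum (\<lambda>l. F (xs @ l)) (a # ys))"
proof (induction xs arbitrary: F)
  case Nil
  show ?case by (simp add: alt_def)
next
  case (Cons x xs)
  note IH = Cons.IH[of "\<lambda>l. F (x # l)"]
  show ?case
  proof (cases xs)
    case Nil
    then show ?thesis by (simp add: alt_def)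
  next
    case (Cons y zs)
    then show ?thesis using IH by (simp add: alt_def)
  qed
qed

text \<open>The overlap is taken at \<open>last xs\<close>. The second sum then consists of one
  merge, whose minus sign turns the exponent \<open>length xs - 1\<close> into
  \<open>length xs\<close>.\<close>

lemma merge_sum_snoc:
  "xs \<noteq> [] \<Longrightarrow> merge_sum F (xs @ [a]) =
     merge_sum (\<lambda>l. F (l @ [a])) xs + alt (length xs) (F (butlast xs @ [last xs * a]))"
  using merge_sum_overlap[of F "butlast xs" "last xs" "[a]"]
  by (cases xs rule: rev_cases) (simp_all add: alt_def)

text \<open>The head merge is the term i = 1; shifting the index in the other terms gives minus the
  sum for the tail, as in the recursion.\<close>

lemma merge_sum_eq_sum:
  fixes F :: "'a::semigroup_mult list \<Rightarrow> 'b::{ring,monoid_mult}"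
  shows "length as = n + 1 \<Longrightarrow>
    (\<Sum>i = 1..n. (- 1) ^ i * F (take (i - 1) as @ [as ! (i - 1) * as ! i] @ drop (i + 1) as)) = merge_sum F as"
proof (induction F as arbitrary: n rule: merge_sum.induct)
  case (1 F a b r)
  then obtain k where k: "n = Suc k" "length r = k" by auto
  have "(\<Sum>i = 1..n. (- 1) ^ i * F (take (i - 1) (a # b # r) @ [(a # b # r) ! (i - 1) * (a # b # r) ! i] @ drop (i + 1) (a # b # r)))
     = - F (a * b # r) + (\<Sum>i = 1..k. (- 1) ^ Suc i * F (take i (a # b # r) @ [(a # b # r) ! i * (a # b # r) ! Suc i] @ drop (Suc i + 1) (a # b # r)))"
    unfolding k(1) by (subst sum.atLeast_Suc_atMost, simp, subst sum.shift_bounds_cl_Suc_ivl) simp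
  also have "\<dots> = - F (a * b # r) - (\<Sum>i = 1..k. (- 1) ^ i * F (a # take (i - 1) (b # r) @ [(b # r) ! (i - 1) * (b # r) ! i] @ drop (i + 1) (b # r)))"
    unfolding diff_conv_add_uminus sum_negf[symmetric]
    by (intro arg_cong2[of _ _ _ _ "(+)"] refl sum.cong) (auto simp: take_Cons' nth_Cons')
  finally show ?case using "1.IH"[of k] k by simp
qed simp_all

lemma lin_on_merge_sum:
  "lin_on s t \<phi> \<Longrightarrow> \<phi> (merge_sum F as) = merge_sum (\<lambda>l. \<phi> (F l)) as"
  by (induction F as rule: merge_sum.induct) (simp_all add: lin_on_minus lin_on_diff lin_on_zero)

lemma (in vector_space) sweedler_merge_sum:
  "sweedler scale T (\<lambda>i. merge_sum (K i) as) = merge_sum (\<lambda>l. sweedler scale T (\<lambda>i. K i l)) as"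
  by (induction "\<lambda>l. sweedler scale T (\<lambda>i. K i l)" as arbitrary: K rule: merge_sum.induct)
    (simp_all add: sweedler_minus sweedler_diff sweedler_zero)

section \<open>Entwining with lists of arguments\<close>

context entwining_structure
begin

lemma LA_mult_right: "LA (\<lambda>x. y * x)" and LA_mult_left: "LA (\<lambda>x. x * y)"
  by (auto intro!: lin_onI simp: algebra_simps A.scale_mult_left A.scale_mult_right)

lemma lin_on_mult_right: "lin_on s sA f \<Longrightarrow> lin_on s sA (\<lambda>x. y * f x)"
  by (rule lin_on_comp[OF LA_mult_right])

lemma lin_on_mult_left: "lin_on s sA f \<Longrightarrow> lin_on s sA (\<lambda>x. f x * y)"
  by (rule lin_on_comp[OF LA_mult_left])

lemma LA_sweedler: "LA \<phi> \<Longrightarrow> \<phi> (sweedler sA T \<beta>) = sweedler sA T (\<lambda>i. \<phi> (\<beta> i))"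
  by (rule lin_on_sweedler) unfold_locales

lemma LC_psi: "bilin_on sA sC sA \<beta> \<Longrightarrow> LC (\<lambda>c. sweedler sA (\<psi> c a) (\<lambda>(x, e). \<beta> x e))"
  by (rule A.lin_on_sweedler_tensor[OF linear_entw_left])

lemma LA_psi: "bilin_on sA sC sA \<beta> \<Longrightarrow> LA (\<lambda>a. sweedler sA (\<psi> c a) (\<lambda>(x, e). \<beta> x e))"
  by (rule A.lin_on_sweedler_tensor[OF linear_entw_right])

lemma LC_Delta: "bilin_on sC sC sA \<gamma> \<Longrightarrow> LC (\<lambda>c. sweedler sA (\<Delta> c) (\<lambda>(x, e). \<gamma> x e))"
  by (rule A.lin_on_sweedler_tensor[OF C.linear_comult])

text \<open>A slot is a decomposition \<open>us @ x # ws\<close> rather than an index, since this is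
  the form that list induction and concatenation produce; \<open>cochains_iff\<close>
  translates.\<close>

definition multilin :: "nat \<Rightarrow> ('a list \<Rightarrow> 'c \<Rightarrow> 'a) \<Rightarrow> bool" where
  "multilin n F \<longleftrightarrow> (\<forall>as. length as = n \<longrightarrow> LC (F as)) \<and>
     (\<forall>us ws c. Suc (length us + length ws) = n \<longrightarrow> LA (\<lambda>x. F (us @ x # ws) c))"

lemma multilinI:
  "(\<And>as. length as = n \<Longrightarrow> LC (F as)) \<Longrightarrow>
   (\<And>us ws c. Suc (length us + length ws) = n \<Longrightarrow> LA (\<lambda>x. F (us @ x # ws) c)) \<Longrightarrow> multilin n F"
  by (simp add: multilin_def)

lemma multilin_LC: "multilin n F \<Longrightarrow> length as = n \<Longrightarrow> LC (F as)"
  and multilin_LA: "multilin n F \<Longrightarrow> Suc (length us + length ws) = n \<Longrightarrow> LA (\<lambda>x. F (us @ x # ws) c)"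
  by (simp_all add: multilin_def)

lemma multilin_Cons: "multilin (Suc n) F \<Longrightarrow> multilin n (\<lambda>as. F (a # as))"
  using multilin_LA[of "Suc n" F "a # us" for us] by (auto intro!: multilinI simp: multilin_def)

lemma multilin_LA_Cons: "multilin n F \<Longrightarrow> Suc (length as) = n \<Longrightarrow> LA (\<lambda>x. F (x # as) c)"
  using multilin_LA[of n F "[]"] by simp

lemma entwine_cong:
  "(\<And>bs e. length bs = length as \<Longrightarrow> F bs e = G bs e) \<Longrightarrow> entwine as c F = entwine as c G"
proof (induction as arbitrary: c F G)
  case (Cons a as)
  have "entwine as e (\<lambda>bs. F (x # bs)) = entwine as e (\<lambda>bs. G (x # bs))" for x e
    by (rule Cons.IH) (simp add: Cons.prems)
  then show ?case by simp
qed simp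

lemma lin_on_entwine_fun:
  "(\<And>bs e. length bs = length as \<Longrightarrow> lin_on s sA (\<lambda>x. F x bs e)) \<Longrightarrow> lin_on s sA (\<lambda>x. entwine as c (F x))"
proof (induction as arbitrary: c F)
  case (Cons a as)
  then show ?case by (auto intro!: A.lin_on_sweedler_fun)
qed simp

lemma LC_entwine: "multilin (length as) F \<Longrightarrow> LC (\<lambda>c. entwine as c F)"
proof (induction as arbitrary: F)
  case Nil
  then show ?case by (simp add: multilin_LC)
next
  case (Cons a as)
  then show ?case
    by (auto intro!: LC_psi bilin_onI lin_on_entwine_fun multilin_LA_Cons multilin_Cons)
qed

lemma bilin_on_entwine_Cons:
  "multilin (Suc (length as)) F \<Longrightarrow> bilin_on sA sC sA (\<lambda>x e. entwine as e (\<lambda>bs. F (x # bs)))"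
  by (auto intro!: bilin_onI lin_on_entwine_fun multilin_LA_Cons LC_entwine multilin_Cons)

text \<open>The entries of \<open>us\<close> are entwined before \<open>x\<close> and only change
  the element of the coalgebra that reaches it. Linearity in \<open>x\<close> is then that of
  \<open>\<psi>\<close>, once the rest is bilinear.\<close>

lemma LA_entwine_slot:
  "multilin (Suc (length us + length ws)) F \<Longrightarrow> LA (\<lambda>x. entwine (us @ x # ws) c F)"
proof (induction us arbitrary: F c)
  case Nil
  then show ?case by (auto intro!: LA_psi bilin_on_entwine_Cons)
next
  case (Cons a us)
  then show ?case by (auto intro!: A.lin_on_sweedler_fun Cons.IH multilin_Cons)
qed

lemma entwine_minus: "entwine as c (\<lambda>bs e. - F bs e) = - entwine as c F"
  and entwine_add: "entwine as c (\<lambda>bs e. F bs e + G bs e) = entwine as c F + entwine as c G"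
  and entwine_diff: "entwine as c (\<lambda>bs e. F bs e - G bs e) = entwine as c F - entwine as c G"
  and entwine_zero: "entwine as c (\<lambda>bs e. 0) = 0"
  by (induction as arbitrary: c F G)
    (simp_all add: A.sweedler_minus A.sweedler_add A.sweedler_diff A.sweedler_zero case_prod_unfold)

lemma LA_entwine: "LA \<phi> \<Longrightarrow> \<phi> (entwine as c F) = entwine as c (\<lambda>bs e. \<phi> (F bs e))"
  by (induction as arbitrary: c F) (simp_all add: LA_sweedler case_prod_unfold)

lemma entwine_sweedler:
  "entwine as c (\<lambda>bs e. sweedler sA T (K bs e)) = sweedler sA T (\<lambda>i. entwine as c (\<lambda>bs e. K bs e i))"
proof (induction as arbitrary: c K)
  case (Cons a as)
  then show ?case by (simp add: case_prod_unfold) (rule A.sweedler_swap)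
qed simp

lemma entwine_merge_sum:
  "entwine as c (\<lambda>bs e. merge_sum (K bs e) us) = merge_sum (\<lambda>l. entwine as c (\<lambda>bs e. K bs e l)) us"
  by (induction "\<lambda>l. entwine as c (\<lambda>bs e. K bs e l)" us arbitrary: K rule: merge_sum.induct)
    (simp_all add: entwine_minus entwine_diff entwine_zero)

lemma entwine_snoc:
  "entwine (as @ [a]) c F = entwine as c (\<lambda>bs e. sweedler sA (\<psi> e a) (\<lambda>(x, e'). F (bs @ [x]) e'))"
  by (induction as arbitrary: c F) simp_all

text \<open>By \<open>entw_mult\<close>, entwining a product is entwining its two factors in turn,
  so neighbours may be merged before or after entwining.\<close>

lemma merge_sum_entwine:
  "Suc n = length as \<Longrightarrow> multilin n F \<Longrightarrow>
    merge_sum (\<lambda>l. entwine l c F) as = entwine as c (\<lambda>bs e. merge_sum (\<lambda>l. F l e) bs)"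
proof (induction as arbitrary: n c F)
  case (Cons a as)
  show ?case
  proof (cases as)
    case Nil
    then show ?thesis by (simp add: A.sweedler_zero case_prod_unfold)
  next
    case (Cons b r)
    with Cons.prems have n: "n = Suc (length r)" by simp
    \<comment> \<open>This is the merge at the head; the other merges lie in \<open>b # r\<close>
      and follow from the induction hypothesis with \<open>x\<close> prepended.\<close>
    have "entwine (a * b # r) c F = sweedler sA (\<psi> c a) (\<lambda>(x, d). sweedler sA (\<psi> d b) (\<lambda>(y, e).
        entwine r e (\<lambda>bs. F (x * y # bs))))"
      using Cons.prems(2) by (simp add: entw_mult_sweedler bilin_on_entwine_Cons n)
    moreover have "merge_sum (\<lambda>l. entwine l e (\<lambda>bs. F (x # bs))) (b # r) =
        entwine (b # r) e (\<lambda>bs e. merge_sum (\<lambda>l. F (x # l) e) bs)" for x e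
      using Cons.IH[of "length r" "\<lambda>bs. F (x # bs)" e] Cons Cons.prems(2) by (simp add: n multilin_Cons)
    ultimately show ?thesis
      by (simp add: Cons case_prod_unfold A.sweedler_merge_sum[symmetric] A.sweedler_minus[symmetric]
          A.sweedler_diff[symmetric] entwine_minus entwine_diff)
  qed
qed simp

section \<open>Multilinear maps woven through the coproduct\<close>

text \<open>In \<open>H d bs e\<close>, \<open>d\<close> stands for c_(1) and \<open>e\<close> for
  c_(2) after it has been entwined with the arguments.\<close>

definition trilin :: "nat \<Rightarrow> ('c \<Rightarrow> 'a list \<Rightarrow> 'c \<Rightarrow> 'a) \<Rightarrow> bool" where
  "trilin n H \<longleftrightarrow> (\<forall>bs e. length bs = n \<longrightarrow> LC (\<lambda>d. H d bs e)) \<and> (\<forall>d. multilin n (H d))"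

lemma trilinI:
  "(\<And>bs e. length bs = n \<Longrightarrow> LC (\<lambda>d. H d bs e)) \<Longrightarrow> (\<And>d. multilin n (H d)) \<Longrightarrow> trilin n H"
  by (simp add: trilin_def)

lemma trilin_LC: "trilin n H \<Longrightarrow> length bs = n \<Longrightarrow> LC (\<lambda>d. H d bs e)"
  and trilin_multilin: "trilin n H \<Longrightarrow> multilin n (H d)"
  by (simp_all add: trilin_def)

text \<open>The common shape of \<open>f \<union> g\<close> and \<open>f \<circ>\<^sub>i g\<close> as functions of the entwined arguments \<open>us\<close>.\<close>
definition weave :: "('c \<Rightarrow> 'a list \<Rightarrow> 'c \<Rightarrow> 'a) \<Rightarrow> 'a list \<Rightarrow> 'c \<Rightarrow> 'a" where
  "weave H us c = sweedler sA (\<Delta> c) (\<lambda>(c1, c2). entwine us c2 (H c1))"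

text \<open>The first term of the differential. When \<open>hd as\<close> is the value of a cochain,
  it is also the inner sum of \<open>sqcup\<close>.\<close>

definition lead :: "('c \<Rightarrow> 'a list \<Rightarrow> 'a) \<Rightarrow> 'c \<Rightarrow> 'a list \<Rightarrow> 'a" where
  "lead f c as = sweedler sA (\<psi> c (hd as)) (\<lambda>(x, e). x * f e (tl as))"

lemma weave_cong:
  "(\<And>d bs e. length bs = length us \<Longrightarrow> H d bs e = K d bs e) \<Longrightarrow> weave H us c = weave K us c"
  using entwine_cong[of us "H d" "K d" for d] by (simp add: weave_def)

lemma weave_minus: "weave (\<lambda>d bs e. - H d bs e) us c = - weave H us c"
  and weave_add: "weave (\<lambda>d bs e. H d bs e + K d bs e) us c = weave H us c + weave K us c"
  and weave_diff: "weave (\<lambda>d bs e. H d bs e - K d bs e) us c = weave H us c - weave K us c"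
  by (simp_all add: weave_def entwine_minus entwine_add entwine_diff A.sweedler_minus A.sweedler_add
      A.sweedler_diff case_prod_unfold)

lemma weave_alt: "weave (\<lambda>d bs e. alt i (H d bs e)) us c = alt i (weave H us c)"
  by (simp add: alt_def weave_minus)

lemma LA_weave: "LA \<phi> \<Longrightarrow> \<phi> (weave H us c) = weave (\<lambda>d bs e. \<phi> (H d bs e)) us c"
  by (simp add: weave_def LA_sweedler LA_entwine case_prod_unfold)

lemma weave_merge_sum:
  "weave (\<lambda>d bs e. merge_sum (K d bs e) vs) us c = merge_sum (\<lambda>l. weave (\<lambda>d bs e. K d bs e l) us c) vs"
  by (simp add: weave_def entwine_merge_sum A.sweedler_merge_sum case_prod_unfold)

lemma weave_snoc:
  "weave H (us @ [a]) c = weave (\<lambda>d bs e. sweedler sA (\<psi> e a) (\<lambda>(x, e'). H d (bs @ [x]) e')) us c"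
  by (simp add: weave_def entwine_snoc)

lemma merge_sum_weave:
  "Suc n = length us \<Longrightarrow> trilin n H \<Longrightarrow>
    merge_sum (\<lambda>l. weave H l c) us = weave (\<lambda>d bs e. merge_sum (\<lambda>l. H d l e) bs) us c"
  by (simp add: weave_def A.sweedler_merge_sum[symmetric] merge_sum_entwine trilin_multilin case_prod_unfold)

lemma multilin_weave:
  assumes "trilin n H"
  shows "multilin n (weave H)"
proof -
  \<comment> \<open>The goals below give the length as \<open>length us\<close> or as a sum over a
    decomposition, hence the extra variable \<open>k\<close>.\<close>
  have "multilin k (H d)" if "k = n" for k d using assms that by (simp add: trilin_multilin)
  then show ?thesis
    unfolding weave_def
    by (intro multilinI)
      (auto intro!: LC_Delta bilin_onI lin_on_entwine_fun LC_entwine A.lin_on_sweedler_fun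
        LA_entwine_slot trilin_LC[OF assms])
qed

lemma lin_on_weave_fun:
  "(\<And>d bs e. length bs = length us \<Longrightarrow> lin_on s sA (\<lambda>x. H x d bs e)) \<Longrightarrow> lin_on s sA (\<lambda>x. weave (H x) us c)"
  unfolding weave_def by (auto intro!: A.lin_on_sweedler_fun lin_on_entwine_fun)

text \<open>By \<open>entw_comult\<close>, splitting the entwined coalgebra element amounts to
  entwining \<open>a\<close> with c_(2) and then with c_(1). The first makes \<open>a\<close> a
  woven argument, the second turns the left multiplication into \<open>lead\<close>.\<close>

lemma lead_weave:
  assumes "trilin (length us) H"
  shows "sweedler sA (\<psi> c a) (\<lambda>(x, e). x * weave H us e)
    = weave (\<lambda>d bs e. lead (\<lambda>d bs. H d bs e) d bs) (a # us) c"
proof -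
  have "sweedler sA (\<psi> c a) (\<lambda>(x, e). x * weave H us e)
      = sweedler sA (\<psi> c a) (\<lambda>(x, e). sweedler sA (\<Delta> e) (\<lambda>(e1, e2). x * entwine us e2 (H e1)))"
    by (simp add: weave_def LA_sweedler[OF LA_mult_right] case_prod_unfold)
  also have "\<dots> = sweedler sA (\<Delta> c) (\<lambda>(c1, c2). sweedler sA (\<psi> c2 a) (\<lambda>(x, e2).
            sweedler sA (\<psi> c1 x) (\<lambda>(y, e1). y * entwine us e2 (H e1))))"
    by (rule entw_comult_sweedler)
      (auto intro!: LA_mult_left lin_on_mult_right lin_on_entwine_fun LC_entwine
        trilin_LC[OF assms] trilin_multilin[OF assms])
  also have "\<dots> = weave (\<lambda>d bs e. lead (\<lambda>d bs. H d bs e) d bs) (a # us) c"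
    by (simp add: weave_def lead_def entwine_sweedler LA_entwine[OF LA_mult_right] case_prod_unfold)
  finally show ?thesis .
qed

section \<open>The two products of cocycles\<close>

text \<open>Overwriting position \<open>i\<close> of a list is the same as filling the gap between
  \<open>take i as\<close> and \<open>drop (Suc i) as\<close>.\<close>

lemma cochains_iff:
  "f \<in> cochains n \<longleftrightarrow> (\<forall>c as. length as \<noteq> n \<longrightarrow> f c as = 0) \<and> multilin n (\<lambda>as c. f c as)"
proof -
  have lin: "Vector_Spaces.linear sC sA = LC" "Vector_Spaces.linear sA sA = LA"
    by (intro ext linear_eq_lin_on; unfold_locales)+
  have "(\<forall>c as i. length as = n \<longrightarrow> i < n \<longrightarrow> LA (\<lambda>x. f c (as[i := x]))) \<longleftrightarrow>
    (\<forall>us ws c. Suc (length us + length ws) = n \<longrightarrow> LA (\<lambda>x. f c (us @ x # ws)))" (is "?L \<longleftrightarrow> ?R")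
  proof
    assume L: ?L
    show ?R
    proof (intro allI impI)
      fix us ws :: "'a list" and c :: 'c assume "Suc (length us + length ws) = n"
      then show "LA (\<lambda>x. f c (us @ x # ws))"
        \<comment> \<open>The entry \<open>0\<close> is a placeholder at the position that
          \<open>x\<close> overwrites.\<close>
        using L[rule_format, of "us @ 0 # ws" "length us" c] by (simp add: list_update_append)
    qed
  next
    assume R: ?R
    show ?L
    proof (intro allI impI)
      fix c :: 'c and as :: "'a list" and i :: nat assume "length as = n" "i < n"
      then show "LA (\<lambda>x. f c (as[i := x]))"
        using R[rule_format, of "take i as" "drop (Suc i) as" c] by (simp add: upd_conv_take_nth_drop)
    qed
  qed
  then show ?thesis unfolding cochains_def multilin_def lin by auto
qed

lemma differential_eq:
  "length as = n + 1 \<Longrightarrow> differential n f c as =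
     lead f c as + merge_sum (f c) as + alt (n + 1) (f c (butlast as) * last as)"
  unfolding differential_def lead_def
  by (subst merge_sum_eq_sum, assumption) (simp only: power_minus_one_mult if_True refl)

lemma cochain_LC: "f \<in> cochains n \<Longrightarrow> length as = n \<Longrightarrow> LC (\<lambda>c. f c as)"
  using multilin_LC[of n "\<lambda>as c. f c as"] by (simp add: cochains_iff)

lemma cochain_slot:
  assumes "f \<in> cochains n" "Suc (length us + length ws) = n" "lin_on s sA h"
  shows "lin_on s sA (\<lambda>x. f c (us @ h x # ws))"
proof -
  have "LA (\<lambda>x. f c (us @ x # ws))"
    using multilin_LA[of n "\<lambda>as c. f c as"] assms(1,2) by (simp add: cochains_iff)
  then show ?thesis using assms(3) by (rule lin_on_comp)
qed

lemma cochain_LA: "f \<in> cochains n \<Longrightarrow> Suc (length us + length ws) = n \<Longrightarrow> LA (\<lambda>x. f c (us @ x # ws))"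
  by (rule cochain_slot[OF _ _ lin_on_id])

lemma cochainI:
  assumes "\<And>c as. length as \<noteq> n \<Longrightarrow> f c as = 0"
    and "\<And>as. length as = n \<Longrightarrow> LC (\<lambda>c. f c as)"
    and "\<And>us ws c. Suc (length us + length ws) = n \<Longrightarrow> LA (\<lambda>x. f c (us @ x # ws))"
  shows "f \<in> cochains n"
  using assms by (auto simp: cochains_iff intro: multilinI)

lemma cocycle_cochain: "f \<in> cocycles n \<Longrightarrow> f \<in> cochains n"
  by (simp add: cocycles_def)

text \<open>The cocycle condition is solved for its inner terms, because these are what cutting a
  \<open>merge_sum\<close> leaves behind.\<close>

lemma cocycle_eq:
  assumes "f \<in> cocycles n" "length as = n + 1"
  shows "merge_sum (f c) as = - lead f c as - alt (n + 1) (f c (butlast as) * last as)"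
proof -
  have "differential n f c as = 0" using assms(1) by (simp add: cocycles_def)
  then show ?thesis using differential_eq[OF assms(2), of f c] by (simp add: algebra_simps eq_neg_iff_add_eq_0)
qed

lemma trilin_cup:
  "f \<in> cochains m \<Longrightarrow> g \<in> cochains n \<Longrightarrow> length vs = n \<Longrightarrow> trilin m (\<lambda>d bs e. f d bs * g e vs)"
  by (intro trilinI multilinI lin_on_mult_left lin_on_mult_right cochain_LC[where n = m]
      cochain_LC[where n = n] cochain_LA[where n = m])

lemma cup_append:
  "length us = m \<Longrightarrow> length vs = n \<Longrightarrow> cup m n f g c (us @ vs) = weave (\<lambda>d bs e. f d bs * g e vs) us c"
  by (simp add: cup_def weave_def)

lemma split_list2:
  assumes "length as = m + n"
  obtains us vs where "as = us @ vs" "length us = m" "length vs = n"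
  using assms by (intro that[of "take m as" "drop m as"]) simp_all

lemma split_list3:
  assumes "length as = m + (n + k)"
  obtains us vs ws where "as = us @ vs @ ws" "length us = m" "length vs = n" "length ws = k"
  using assms by (elim split_list2) (simp add: that)

lemma split_slot2:
  assumes "Suc (length us + length ws) = m + n"
  obtains vs ts where "ws = vs @ ts" "Suc (length us + length vs) = m" "length ts = n"
  | vs ts where "us = vs @ ts" "length vs = m" "Suc (length ts + length ws) = n"
proof (cases "length us < m")
  case True
  then show ?thesis
    using assms by (intro that(1)[of "take (m - length us - 1) ws" "drop (m - length us - 1) ws"]) simp_all
next
  case False
  then show ?thesis
    using assms by (intro that(2)[of "take m us" "drop m us"]) simp_all
qed

lemma cup_cochain:
  assumes f: "f \<in> cochains m" and g: "g \<in> cochains n"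
  shows "cup m n f g \<in> cochains (m + n)"
proof (rule cochainI)
  show "cup m n f g c as = 0" if "length as \<noteq> m + n" for c as
    using that by (simp add: cup_def)
  show "LC (\<lambda>c. cup m n f g c as)" if "length as = m + n" for as
    using that
  proof (rule split_list2)
    fix us vs assume "as = us @ vs" "length us = m" "length vs = n"
    then show ?thesis using multilin_LC[OF multilin_weave[OF trilin_cup[OF f g]]] by (simp add: cup_append)
  qed
  show "LA (\<lambda>x. cup m n f g c (us @ x # ws))" if "Suc (length us + length ws) = m + n" for us ws c
    using that
  proof (rule split_slot2)
    fix vs ts assume *: "ws = vs @ ts" "Suc (length us + length vs) = m" "length ts = n"
    then have "cup m n f g c (us @ x # ws) = weave (\<lambda>d bs e. f d bs * g e ts) (us @ x # vs) c" for x
      using cup_append[of "us @ x # vs" m ts n f g c] by simp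
    then show ?thesis using multilin_LA[OF multilin_weave[OF trilin_cup[OF f g]]] * by simp
  next
    fix vs ts assume *: "us = vs @ ts" "length vs = m" "Suc (length ts + length ws) = n"
    \<comment> \<open>A slot beyond the first \<open>m\<close> is not woven: it enters
      \<open>g\<close> directly and is a parameter of the weave.\<close>
    then have "cup m n f g c (us @ x # ws) = weave (\<lambda>d bs e. f d bs * g e (ts @ x # ws)) vs c" for x
      using cup_append[of vs m "ts @ x # ws" n f g c] by simp
    then show ?thesis using * by (auto intro!: lin_on_weave_fun lin_on_mult_right cochain_LA[OF g])
  qed
qed

lemma LA_lead: "f \<in> cochains (length as) \<Longrightarrow> LA (\<lambda>x. lead f c (x # as))"
  and LC_lead: "f \<in> cochains (length as) \<Longrightarrow> LC (\<lambda>c. lead f c (x # as))"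
  unfolding lead_def
  by (auto intro!: LA_psi LC_psi bilin_onI LA_mult_left lin_on_mult_right cochain_LC)

lemma lead_slot:
  "f \<in> cochains (Suc (length us + length ws)) \<Longrightarrow> LA (\<lambda>x. lead f c (a # us @ x # ws))"
  unfolding lead_def by (auto intro!: A.lin_on_sweedler_fun lin_on_mult_right cochain_LA)

text \<open>Passing \<open>c\<close> through a product is passing it through \<open>x\<close> and
  then through \<open>y\<close>; the factor \<open>z\<close> left by \<open>x\<close> comes out in
  front.\<close>

lemma lead_mult:
  assumes "f \<in> cochains (length as)"
  shows "lead f c (x * y # as) = sweedler sA (\<psi> c x) (\<lambda>(z, e). z * lead f e (y # as))"
proof -
  have "bilin_on sA sC sA (\<lambda>z e. z * f e as)"
    using assms by (intro bilin_onI LA_mult_left lin_on_mult_right cochain_LC) simp_all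
  from entw_mult_sweedler[OF this] show ?thesis
    by (simp add: lead_def LA_sweedler[OF LA_mult_right] case_prod_unfold mult.assoc)
qed

lemma sqcup_append:
  "length us = m \<Longrightarrow> length vs = n \<Longrightarrow>
    sqcup m n f g c (us @ vs) = sweedler sA (\<Delta> c) (\<lambda>(c1, c2). lead g c1 (f c2 us # vs))"
  by (simp add: sqcup_def lead_def)

lemma sqcup_cochain:
  assumes f: "f \<in> cochains m" and g: "g \<in> cochains n"
  shows "sqcup m n f g \<in> cochains (m + n)"
proof (rule cochainI)
  show "sqcup m n f g c as = 0" if "length as \<noteq> m + n" for c as
    using that by (simp add: sqcup_def)
  show "LC (\<lambda>c. sqcup m n f g c as)" if "length as = m + n" for as
    using that
  proof (rule split_list2)
    fix us vs assume *: "as = us @ vs" "length us = m" "length vs = n"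
    have "bilin_on sC sC sA (\<lambda>c1 c2. lead g c1 (f c2 us # vs))"
      using g * by (auto intro!: bilin_onI LC_lead lin_on_comp[OF LA_lead] cochain_LC[OF f])
    then show ?thesis using * by (simp add: sqcup_append LC_Delta)
  qed
  show "LA (\<lambda>x. sqcup m n f g c (us @ x # ws))" if "Suc (length us + length ws) = m + n" for us ws c
    using that
  proof (rule split_slot2)
    fix vs ts assume *: "ws = vs @ ts" "Suc (length us + length vs) = m" "length ts = n"
    then have "sqcup m n f g c (us @ x # ws) = sweedler sA (\<Delta> c) (\<lambda>(c1, c2). lead g c1 (f c2 (us @ x # vs) # ts))" for x
      using sqcup_append[of "us @ x # vs" m ts n f g c] by simp
    then show ?thesis using g *
      by (auto intro!: A.lin_on_sweedler_fun lin_on_comp[OF LA_lead] cochain_LA[OF f])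
  next
    fix vs ts assume *: "us = vs @ ts" "length vs = m" "Suc (length ts + length ws) = n"
    then have "sqcup m n f g c (us @ x # ws) = sweedler sA (\<Delta> c) (\<lambda>(c1, c2). lead g c1 (f c2 vs # ts @ x # ws))" for x
      using sqcup_append[of vs m "ts @ x # ws" n f g c] by simp
    then show ?thesis using g * by (auto intro!: A.lin_on_sweedler_fun lead_slot)
  qed
qed

text \<open>The argument list is presented already cut at position \<open>i\<close>, with the entry
  \<open>a\<close> that \<open>merge_sum_overlap\<close> shares between both halves.\<close>

lemma cocycleI:
  assumes "f \<in> cochains n"
    and "\<And>us a vs c. length us = i \<Longrightarrow> length vs = n - i \<Longrightarrow>
      lead f c (us @ a # vs) + merge_sum (f c) (us @ a # vs)
        + alt (n + 1) (f c (butlast (us @ a # vs)) * last (us @ a # vs)) = 0"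
    and "i \<le> n"
  shows "f \<in> cocycles n"
proof -
  have "differential n f c as = 0" for c as
  proof (cases "length as = n + 1")
    case True
    then have "as = take i as @ as ! i # drop (Suc i) as"
      using assms(3) by (intro id_take_nth_drop) simp
    then show ?thesis
      using assms(2)[of "take i as" "drop (Suc i) as" c "as ! i"] assms(3) True differential_eq[OF True, of f c]
      by simp
  next
    case False
    then show ?thesis by (simp add: differential_def)
  qed
  then show ?thesis using assms(1) by (auto simp: cocycles_def)
qed

text \<open>Cutting at \<open>a\<close> leaves the terms of df on \<open>us @ [a]\<close> without
  its last one, and those of dg on \<open>a # vs\<close> without its first one. The two missing
  terms are both \<open>?Y\<close> up to sign, and the signs cancel.\<close>

lemma cup_cocycle:
  assumes f: "f \<in> cocycles m" and g: "g \<in> cocycles n"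
  shows "cup m n f g \<in> cocycles (m + n)"
proof (rule cocycleI)
  note fc = cocycle_cochain[OF f] and gc = cocycle_cochain[OF g]
  show "cup m n f g \<in> cochains (m + n)" by (rule cup_cochain[OF fc gc])
  show "m \<le> m + n" by simp
  fix us vs :: "'a list" and a c
  assume us: "length us = m" and "length vs = m + n - m"
  then have vs: "length vs = n" by simp
  let ?as = "us @ a # vs"
  let ?Y = "weave (\<lambda>d bs e. f d bs * lead g e (a # vs)) us c"
  let ?Z = "weave (\<lambda>d bs e. f d bs * (g e (butlast (a # vs)) * last (a # vs))) us c"
  have lead_part: "lead (cup m n f g) c ?as = weave (\<lambda>d bs e. lead f d bs * g e vs) (us @ [a]) c"
  proof -
    \<comment> \<open>The first argument belongs to \<open>us\<close>, or is \<open>a\<close> if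
      \<open>us\<close> is empty; in both cases it is the head of \<open>us @ [a]\<close>.\<close>
    obtain b ts where ts: "us @ [a] = b # ts" by (cases "us @ [a]") simp_all
    with us have len: "length ts = m" by (metis add_diff_cancel_right' length_append_singleton length_Cons Suc_inject)
    have hd_tl: "hd ?as = b" "tl ?as = ts @ vs" using ts by (cases us; simp)+
    have "lead (cup m n f g) c ?as
        = sweedler sA (\<psi> c b) (\<lambda>(x, e). x * weave (\<lambda>d bs e. f d bs * g e vs) ts e)"
      by (simp add: lead_def hd_tl cup_append len vs)
    also have "\<dots> = weave (\<lambda>d bs e. lead (\<lambda>d bs. f d bs * g e vs) d bs) (b # ts) c"
      by (rule lead_weave) (use trilin_cup[OF fc gc vs] len in simp)
    also have "\<dots> = weave (\<lambda>d bs e. lead f d bs * g e vs) (b # ts) c"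
      by (rule weave_cong) (simp add: lead_def LA_sweedler[OF LA_mult_left] mult.assoc case_prod_unfold)
    finally show ?thesis by (simp add: ts)
  qed
  have "merge_sum (cup m n f g c) ?as
      = merge_sum (\<lambda>l. cup m n f g c (l @ vs)) (us @ [a]) + alt m (merge_sum (\<lambda>l. cup m n f g c (us @ l)) (a # vs))"
    by (simp add: merge_sum_overlap[of _ us a vs] us)
  also have "merge_sum (\<lambda>l. cup m n f g c (l @ vs)) (us @ [a])
      = merge_sum (\<lambda>l. weave (\<lambda>d bs e. f d bs * g e vs) l c) (us @ [a])"
    by (rule merge_sum_cong) (simp add: cup_append us vs)
  also have "\<dots> = weave (\<lambda>d bs e. merge_sum (f d) bs * g e vs) (us @ [a]) c"
    by (subst merge_sum_weave[OF _ trilin_cup[OF fc gc vs]])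
      (simp_all add: us lin_on_merge_sum[OF LA_mult_left])
  also have "merge_sum (\<lambda>l. cup m n f g c (us @ l)) (a # vs)
      = merge_sum (\<lambda>l. weave (\<lambda>d bs e. f d bs * g e l) us c) (a # vs)"
    by (rule merge_sum_cong) (simp add: cup_append us vs)
  also have "\<dots> = weave (\<lambda>d bs e. f d bs * merge_sum (g e) (a # vs)) us c"
    by (simp add: weave_merge_sum[symmetric] lin_on_merge_sum[OF LA_mult_right])
  also have "\<dots> = weave (\<lambda>d bs e. - (f d bs * lead g e (a # vs))
       - alt (n + 1) (f d bs * (g e (butlast (a # vs)) * last (a # vs)))) us c"
    by (rule weave_cong) (simp add: cocycle_eq[OF g] vs alt_def algebra_simps)
  also have "\<dots> = - ?Y - alt (n + 1) ?Z"
    by (simp only: weave_diff weave_minus weave_alt)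
  finally have merge_part: "merge_sum (cup m n f g c) ?as =
    weave (\<lambda>d bs e. merge_sum (f d) bs * g e vs) (us @ [a]) c + alt m (- ?Y - alt (n + 1) ?Z)" .
  have "weave (\<lambda>d bs e. lead f d bs * g e vs) (us @ [a]) c + weave (\<lambda>d bs e. merge_sum (f d) bs * g e vs) (us @ [a]) c
      = weave (\<lambda>d bs e. - alt (m + 1) (f d (butlast bs) * last bs * g e vs)) (us @ [a]) c"
    unfolding weave_add[symmetric]
    by (rule weave_cong) (simp add: cocycle_eq[OF f] us alt_def algebra_simps)
  also have "\<dots> = - alt (m + 1) (weave (\<lambda>d bs e. f d (butlast bs) * last bs * g e vs) (us @ [a]) c)"
    by (simp only: weave_minus weave_alt)
  \<comment> \<open>The last woven argument \<open>a\<close> can be entwined within the weave over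
    \<open>us\<close>; multiplied onto \<open>g\<close> from the left it gives the first term of
    dg.\<close>
  also have "weave (\<lambda>d bs e. f d (butlast bs) * last bs * g e vs) (us @ [a]) c = ?Y"
    by (simp add: weave_snoc lead_def LA_sweedler[OF LA_mult_right] mult.assoc case_prod_unfold)
  finally have f_part: "weave (\<lambda>d bs e. lead f d bs * g e vs) (us @ [a]) c
    + weave (\<lambda>d bs e. merge_sum (f d) bs * g e vs) (us @ [a]) c = - alt (m + 1) ?Y" .
  \<comment> \<open>\<open>butlast\<close> and \<open>last\<close> of \<open>a # vs\<close> stay
    unevaluated, which covers \<open>n = 0\<close> without a separate case.\<close>
  have "cup m n f g c (butlast ?as) * last ?as
      = weave (\<lambda>d bs e. f d bs * g e (butlast (a # vs))) us c * last (a # vs)"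
    using cup_append[of us m "butlast (a # vs)" n f g c] us vs by (simp add: butlast_append del: butlast.simps last.simps)
  also have "\<dots> = ?Z"
    by (simp only: LA_weave[OF LA_mult_left] mult.assoc)
  finally have last_part: "cup m n f g c (butlast ?as) * last ?as = ?Z" .
  show "lead (cup m n f g) c ?as + merge_sum (cup m n f g c) ?as
      + alt (m + n + 1) (cup m n f g c (butlast ?as) * last ?as) = 0"
    unfolding lead_part merge_part last_part add.assoc[symmetric] f_part
    by (cases "even m"; cases "even n") (simp_all add: alt_def)
qed

text \<open>Again the sum is cut at \<open>a\<close>. The term with first entry
  \<open>f c2 us * a\<close> comes from the last term of df and, through \<open>lead_mult\<close>,
  from the first term of dg, with opposite signs.\<close>

lemma sqcup_cocycle:
  assumes f: "f \<in> cocycles m" and g: "g \<in> cocycles n"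
  shows "sqcup m n f g \<in> cocycles (m + n)"
proof (rule cocycleI)
  note fc = cocycle_cochain[OF f] and gc = cocycle_cochain[OF g]
  show "sqcup m n f g \<in> cochains (m + n)" by (rule sqcup_cochain[OF fc gc])
  show "m \<le> m + n" by simp
  fix us vs :: "'a list" and a c
  assume us: "length us = m" and "length vs = m + n - m"
  then have vs: "length vs = n" by simp
  note gc' = gc[folded vs]
  let ?as = "us @ a # vs" and ?D = "\<lambda>K. sweedler sA (\<Delta> c) (\<lambda>(c1, c2). K c1 c2)"
  have lead_part: "lead (sqcup m n f g) c ?as = ?D (\<lambda>c1 c2. lead g c1 (lead f c2 (us @ [a]) # vs))"
  proof -
    obtain b ts where ts: "us @ [a] = b # ts" by (cases "us @ [a]") simp_all
    with us have len: "length ts = m" by (metis add_diff_cancel_right' length_append_singleton length_Cons Suc_inject)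
    have hd_tl: "hd ?as = b" "tl ?as = ts @ vs" using ts by (cases us; simp)+
    have "lead (sqcup m n f g) c ?as
        = sweedler sA (\<psi> c b) (\<lambda>(x, e). sweedler sA (\<Delta> e) (\<lambda>(e1, e2). x * lead g e1 (f e2 ts # vs)))"
      by (simp add: lead_def[of "sqcup m n f g"] hd_tl sqcup_append len vs LA_sweedler[OF LA_mult_right] case_prod_unfold)
    \<comment> \<open>The axiom entwines \<open>b\<close> with c_(2) first and the result with
      c_(1), which matches \<open>lead f\<close> nested inside \<open>lead g\<close>.\<close>
    also have "\<dots> = ?D (\<lambda>c1 c2. sweedler sA (\<psi> c2 b) (\<lambda>(x, e2).
            sweedler sA (\<psi> c1 x) (\<lambda>(y, e1). y * lead g e1 (f e2 ts # vs))))"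
      by (rule entw_comult_sweedler)
        (auto intro!: LA_mult_left lin_on_mult_right LC_lead gc' lin_on_comp[OF LA_lead] cochain_LC[OF fc len])
    also have "\<dots> = ?D (\<lambda>c1 c2. lead g c1 (lead f c2 (b # ts) # vs))"
      by (simp add: lead_mult[OF gc', symmetric, unfolded case_prod_unfold] lead_def[of f] LA_sweedler[OF LA_lead[OF gc']] case_prod_unfold)
    finally show ?thesis by (simp add: ts)
  qed
  \<comment> \<open>The merges inside \<open>a # vs\<close> are rewritten by dg = 0 and multiplied
    by the entwined \<open>y\<close>, so that the first term of dg absorbs \<open>a\<close> into
    \<open>y\<close>.\<close>
  have g_part: "sweedler sA (\<psi> d y) (\<lambda>(x, e). x * merge_sum (g e) (a # vs))
      = - lead g d (y * a # vs) - alt (n + 1) (lead g d (y # butlast (a # vs)) * last (a # vs))" for d y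
  proof -
    have "lead g d (y # bs) * z = sweedler sA (\<psi> d y) (\<lambda>(x, e). x * (g e bs * z))" for bs z
      by (simp add: lead_def LA_sweedler[OF LA_mult_left] mult.assoc case_prod_unfold)
    moreover have "merge_sum (g e) (a # vs)
        = - lead g e (a # vs) - alt (n + 1) (g e (butlast (a # vs)) * last (a # vs))" for e
      using vs by (intro cocycle_eq[OF g]) simp
    ultimately show ?thesis
      by (cases "even n") (simp_all only: lead_mult[OF gc'] alt_def mult_minus_right right_diff_distrib
        A.sweedler_minus A.sweedler_diff case_prod_unfold even_add odd_one simp_thms if_True if_False)
  qed
  have "merge_sum (sqcup m n f g c) ?as
      = merge_sum (\<lambda>l. sqcup m n f g c (l @ vs)) (us @ [a]) + alt m (merge_sum (\<lambda>l. sqcup m n f g c (us @ l)) (a # vs))"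
    by (simp add: merge_sum_overlap[of _ us a vs] us)
  also have "merge_sum (\<lambda>l. sqcup m n f g c (l @ vs)) (us @ [a])
      = merge_sum (\<lambda>l. ?D (\<lambda>c1 c2. lead g c1 (f c2 l # vs))) (us @ [a])"
    by (rule merge_sum_cong) (simp add: sqcup_append us vs)
  also have "\<dots> = ?D (\<lambda>c1 c2. lead g c1 (merge_sum (f c2) (us @ [a]) # vs))"
    by (simp add: A.sweedler_merge_sum[symmetric] lin_on_merge_sum[OF LA_lead[OF gc']] case_prod_unfold)
  also have "merge_sum (\<lambda>l. sqcup m n f g c (us @ l)) (a # vs)
      = merge_sum (\<lambda>l. ?D (\<lambda>c1 c2. lead g c1 (f c2 us # l))) (a # vs)"
    by (rule merge_sum_cong) (simp add: sqcup_append us vs)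
  also have "\<dots> = ?D (\<lambda>c1 c2. sweedler sA (\<psi> c1 (f c2 us)) (\<lambda>(x, e). x * merge_sum (g e) (a # vs)))"
    by (simp add: A.sweedler_merge_sum[symmetric] lead_def lin_on_merge_sum[OF LA_mult_right] case_prod_unfold)
  also have "\<dots> = ?D (\<lambda>c1 c2. - lead g c1 (f c2 us * a # vs)
      - alt (n + 1) (lead g c1 (f c2 us # butlast (a # vs)) * last (a # vs)))"
    by (simp only: g_part)
  finally have merge_part: "merge_sum (sqcup m n f g c) ?as
     = ?D (\<lambda>c1 c2. lead g c1 (merge_sum (f c2) (us @ [a]) # vs))
     + alt m (?D (\<lambda>c1 c2. - lead g c1 (f c2 us * a # vs)
      - alt (n + 1) (lead g c1 (f c2 us # butlast (a # vs)) * last (a # vs))))" .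
  have f_part: "merge_sum (f c2) (us @ [a]) = - lead f c2 (us @ [a]) - alt (m + 1) (f c2 us * a)" for c2
    using cocycle_eq[OF f, of "us @ [a]" c2] us by simp
  have "sqcup m n f g c (butlast ?as) * last ?as
      = ?D (\<lambda>c1 c2. lead g c1 (f c2 us # butlast (a # vs))) * last (a # vs)"
    using sqcup_append[of us m "butlast (a # vs)" n f g c] us vs by (simp add: butlast_append del: butlast.simps last.simps)
  also have "\<dots> = ?D (\<lambda>c1 c2. lead g c1 (f c2 us # butlast (a # vs)) * last (a # vs))"
    by (simp only: LA_sweedler[OF LA_mult_left] case_prod_unfold)
  finally have last_part: "sqcup m n f g c (butlast ?as) * last ?as = \<dots>" .
  show "lead (sqcup m n f g) c ?as + merge_sum (sqcup m n f g c) ?as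
      + alt (m + n + 1) (sqcup m n f g c (butlast ?as) * last ?as) = 0"
    unfolding lead_part merge_part last_part f_part
    by (cases "even m"; cases "even n")
      (simp_all add: alt_def lin_on_diff[OF LA_lead[OF gc']] lin_on_add[OF LA_lead[OF gc']]
        lin_on_minus[OF LA_lead[OF gc']]
        A.sweedler_diff A.sweedler_add A.sweedler_minus case_prod_unfold del: butlast.simps last.simps)
qed

section \<open>Partial compositions\<close>

text \<open>The slot \<open>i\<close> of insertion counts from 0.\<close>
definition circ :: "nat \<Rightarrow> nat \<Rightarrow> nat \<Rightarrow> ('c \<Rightarrow> 'a list \<Rightarrow> 'a) \<Rightarrow> ('c \<Rightarrow> 'a list \<Rightarrow> 'a) \<Rightarrow> 'c \<Rightarrow> 'a list \<Rightarrow> 'a" where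
  "circ i m n f g c as = (if Suc (length as) = m + n then
     weave (\<lambda>d bs e. f d (bs @ g e (take n (drop i as)) # drop (i + n) as)) (take i as) c
   else 0)"

lemma circ_append:
  "length us = i \<Longrightarrow> length vs = n \<Longrightarrow> Suc (i + length ws) = m \<Longrightarrow>
    circ i m n f g c (us @ vs @ ws) = weave (\<lambda>d bs e. f d (bs @ g e vs # ws)) us c"
  by (simp add: circ_def)

lemma trilin_circ:
  assumes f: "f \<in> cochains m" and g: "g \<in> cochains n" and "length vs = n" "Suc (i + length ws) = m"
  shows "trilin i (\<lambda>d bs e. f d (bs @ g e vs # ws))"
proof (intro trilinI multilinI)
  show "LC (\<lambda>d. f d (bs @ g e vs # ws))" if "length bs = i" for bs e
    using assms that by (intro cochain_LC[OF f]) simp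
  show "LC (\<lambda>e. f d (bs @ g e vs # ws))" if "length bs = i" for bs d
    using assms that by (intro cochain_slot[OF f] cochain_LC[OF g]) simp_all
  show "LA (\<lambda>x. f d ((bs @ x # cs) @ g e vs # ws))" if "Suc (length bs + length cs) = i" for bs cs d e
    using cochain_LA[OF f, of bs "cs @ g e vs # ws"] assms that by simp
qed

lemma circ_cochain:
  assumes f: "f \<in> cochains m" and g: "g \<in> cochains n" and i: "i < m" and N: "Suc N = m + n"
  shows "circ i m n f g \<in> cochains N"
proof (rule cochainI)
  \<comment> \<open>The three summands count the arguments before the insertion, those of
    \<open>g\<close> and those after it; a varied slot lies in one of these blocks.\<close>
  have N': "N = i + (n + (m - Suc i))" using i N by simp
  show "circ i m n f g c as = 0" if "length as \<noteq> N" for c as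
    using that N by (simp add: circ_def)
  show "LC (\<lambda>c. circ i m n f g c as)" if as: "length as = N" for as
  proof -
    obtain us vs ws where "as = us @ vs @ ws" "length us = i" "length vs = n" "length ws = m - Suc i"
      using as unfolding N' by (rule split_list3)
    then show ?thesis
      using multilin_LC[OF multilin_weave[OF trilin_circ[OF f g]], of vs i ws us] i by (simp add: circ_append)
  qed
  show "LA (\<lambda>x. circ i m n f g c (us @ x # ws))" if "Suc (length us + length ws) = N" for us ws c
    using that unfolding N'
  proof (rule split_slot2)
    fix vs ts assume *: "ws = vs @ ts" "Suc (length us + length vs) = i" "length ts = n + (m - Suc i)"
    from *(3) obtain ps qs where ts: "ts = ps @ qs" "length ps = n" "length qs = m - Suc i"
      by (rule split_list2)
    have "circ i m n f g c (us @ x # ws) = weave (\<lambda>d bs e. f d (bs @ g e ps # qs)) (us @ x # vs) c" for x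
      using circ_append[of "us @ x # vs" i ps n qs m f g c] * ts i by simp
    then show ?thesis using multilin_LA[OF multilin_weave[OF trilin_circ[OF f g]], of ps i qs us vs] * ts i by simp
  next
    fix vs ts assume *: "us = vs @ ts" "length vs = i" "Suc (length ts + length ws) = n + (m - Suc i)"
    from *(3) show ?thesis
    proof (rule split_slot2)
      fix ps qs assume **: "ws = ps @ qs" "Suc (length ts + length ps) = n" "length qs = m - Suc i"
      have "circ i m n f g c (us @ x # ws) = weave (\<lambda>d bs e. f d (bs @ g e (ts @ x # ps) # qs)) vs c" for x
        using circ_append[of vs i "ts @ x # ps" n qs m f g c] * ** i by simp
      then show ?thesis using * ** i by (auto intro!: lin_on_weave_fun cochain_slot[OF f] cochain_LA[OF g])
    next
      fix ps qs assume **: "ts = ps @ qs" "length ps = n" "Suc (length qs + length ws) = m - Suc i"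
      have "circ i m n f g c (us @ x # ws) = weave (\<lambda>d bs e. f d (bs @ g e ps # qs @ x # ws)) vs c" for x
        using circ_append[of vs i ps n "qs @ x # ws" m f g c] * ** i by simp
      moreover have "LA (\<lambda>x. f d (bs @ g e ps # qs @ x # ws))" if "length bs = i" for d bs e
        using cochain_LA[OF f, of "bs @ g e ps # qs" ws] that ** i by simp
      ultimately show ?thesis using * by (auto intro!: lin_on_weave_fun)
    qed
  qed
qed

section \<open>The differential of a partial composition\<close>

text \<open>The sum L_i for \<open>i = length us\<close>: the first term of df and the merges up to
  the one of the inserted value with its left neighbour.\<close>

definition left_part ::
    "('c \<Rightarrow> 'a list \<Rightarrow> 'a) \<Rightarrow> ('c \<Rightarrow> 'a list \<Rightarrow> 'a) \<Rightarrow> 'a list \<Rightarrow> 'a list \<Rightarrow> 'a list \<Rightarrow> 'c \<Rightarrow> 'a" where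
  "left_part f g us vs ws = weave (\<lambda>d bs e.
     lead f d (bs @ g e vs # ws) + merge_sum (\<lambda>l. f d (l @ ws)) (bs @ [g e vs])) us"

definition right_part ::
    "('c \<Rightarrow> 'a list \<Rightarrow> 'a) \<Rightarrow> ('c \<Rightarrow> 'a list \<Rightarrow> 'a) \<Rightarrow> 'a list \<Rightarrow> 'a list \<Rightarrow> 'a list \<Rightarrow> 'c \<Rightarrow> 'a" where
  "right_part f g us vs ws = weave (\<lambda>d bs e.
     alt (length us) (merge_sum (\<lambda>l. f d (bs @ l)) (g e vs # ws))
     + alt (Suc (length us + length ws)) (f d (butlast (bs @ g e vs # ws)) * last (g e vs # ws))) us"

text \<open>The condition df = 0 on the \<open>m + 1\<close> entries
  \<open>bs @ g e vs # ws\<close>, its inner terms cut at the inserted value.\<close>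

lemma right_part_eq:
  assumes f: "f \<in> cocycles m" and "length us + length ws = m"
  shows "right_part f g us vs ws c = - left_part f g us vs ws c"
  unfolding left_part_def right_part_def weave_minus[symmetric]
proof (rule weave_cong)
  fix d e and bs :: "'a list" assume bs: "length bs = length us"
  have "merge_sum (f d) (bs @ g e vs # ws) = - lead f d (bs @ g e vs # ws)
      - alt (m + 1) (f d (butlast (bs @ g e vs # ws)) * last (bs @ g e vs # ws))"
    by (rule cocycle_eq[OF f]) (use assms bs in simp)
  then show "alt (length us) (merge_sum (\<lambda>l. f d (bs @ l)) (g e vs # ws))
     + alt (Suc (length us + length ws)) (f d (butlast (bs @ g e vs # ws)) * last (g e vs # ws))
     = - (lead f d (bs @ g e vs # ws) + merge_sum (\<lambda>l. f d (l @ ws)) (bs @ [g e vs]))"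
    using assms(2) bs by (simp add: merge_sum_overlap[of "f d" bs] algebra_simps del: butlast.simps last.simps)
qed

text \<open>The block \<open>vs\<close> is one longer than \<open>g\<close> takes. By dg = 0 the
  merges inside it become products of the value of \<open>g\<close> with the entwined first entry
  (\<open>?Y\<close>) and with the last entry (\<open>?Z\<close>). Now \<open>?L\<close>,
  \<open>?X\<close>, \<open>?Y\<close> form the left part with \<open>hd vs\<close> moved into
  \<open>us\<close>, and \<open>?Z\<close>, \<open>?W\<close>, \<open>?R\<close> the right part with
  \<open>last vs\<close> moved into \<open>ws\<close>.\<close>

lemma differential_circ:
  assumes fc: "f \<in> cochains m" and g: "g \<in> cocycles n" and N: "Suc N = m + n"
    and us: "length us = i" and vs: "length vs = Suc n" and ws: "Suc (i + length ws) = m"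
  shows "differential N (circ i m n f g) c (us @ vs @ ws)
    = left_part f g (us @ [hd vs]) (tl vs) ws c + alt (n + 1) (right_part f g us (butlast vs) (last vs # ws) c)"
proof -
  note gc = cocycle_cochain[OF g]
  let ?as = "us @ vs @ ws" and ?C = "circ i m n f g"
  obtain a vs1 where vs1: "vs = a # vs1" "length vs1 = n" using vs by (cases vs) simp_all
  obtain vs2 b where vs2: "vs = vs2 @ [b]" "length vs2 = n" using vs by (cases vs rule: rev_cases) simp_all
  let ?X = "weave (\<lambda>d bs e. merge_sum (\<lambda>l. f d (l @ g e vs1 # ws)) bs) (us @ [a]) c"
  let ?Y = "weave (\<lambda>d bs e. f d (bs @ lead g e vs # ws)) us c"
  let ?Z = "weave (\<lambda>d bs e. f d (bs @ (g e vs2 * b) # ws)) us c"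
  let ?W = "weave (\<lambda>d bs e. merge_sum (\<lambda>l. f d (bs @ g e vs2 # l)) (b # ws)) us c"
  let ?L = "weave (\<lambda>d bs e. lead f d (bs @ g e vs1 # ws)) (us @ [a]) c"
  let ?R = "weave (\<lambda>d bs e. f d (bs @ g e vs2 # butlast (b # ws)) * last (b # ws)) us c"

  have lead_part: "lead ?C c ?as = ?L"
  proof -
    \<comment> \<open>Within this block \<open>b\<close> is the first argument of the whole list and
      shadows the last entry of \<open>vs\<close>.\<close>
    obtain b ts where ts: "us @ [a] = b # ts" by (cases "us @ [a]") simp_all
    with us have len: "length ts = i" by (metis add_diff_cancel_right' length_append_singleton length_Cons Suc_inject)
    have hd_tl: "hd ?as = b" "tl ?as = ts @ vs1 @ ws" using ts vs1 by (cases us; simp)+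
    have "lead ?C c ?as
        = sweedler sA (\<psi> c b) (\<lambda>(x, e). x * weave (\<lambda>d bs e. f d (bs @ g e vs1 # ws)) ts e)"
      by (simp add: lead_def hd_tl circ_append len vs1(2) ws)
    also have "\<dots> = weave (\<lambda>d bs e. lead (\<lambda>d bs. f d (bs @ g e vs1 # ws)) d bs) (b # ts) c"
      by (rule lead_weave) (use trilin_circ[OF fc gc vs1(2) ws] len in simp)
    also have "\<dots> = weave (\<lambda>d bs e. lead f d (bs @ g e vs1 # ws)) (b # ts) c"
      by (rule weave_cong) (auto simp: lead_def length_Suc_conv)
    finally show ?thesis by (simp add: ts)
  qed

  have "merge_sum (?C c) ?as = merge_sum (\<lambda>l. ?C c (l @ vs1 @ ws)) (us @ [a])
      + alt i (merge_sum (\<lambda>l. ?C c (us @ l)) (vs @ ws))"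
    \<comment> \<open>The list is cut at \<open>a\<close> and then at \<open>b\<close>; for
      \<open>n = 0\<close> these are the same entry and the middle sum is empty.\<close>
    using merge_sum_overlap[of "?C c" us a "vs1 @ ws"] by (simp add: us vs1)
  also have "merge_sum (\<lambda>l. ?C c (us @ l)) (vs @ ws) = merge_sum (\<lambda>l. ?C c (us @ l @ ws)) vs
      + alt n (merge_sum (\<lambda>l. ?C c (us @ vs2 @ l)) (b # ws))"
    using merge_sum_overlap[of "\<lambda>l. ?C c (us @ l)" vs2 b ws] by (simp add: vs2)
  also have "merge_sum (\<lambda>l. ?C c (l @ vs1 @ ws)) (us @ [a])
      = merge_sum (\<lambda>l. weave (\<lambda>d bs e. f d (bs @ g e vs1 # ws)) l c) (us @ [a])"
    by (rule merge_sum_cong) (simp add: circ_append us vs1 ws)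
  also have "\<dots> = ?X"
    by (subst merge_sum_weave[OF _ trilin_circ[OF fc gc vs1(2) ws]]) (simp_all add: us)
  also have "merge_sum (\<lambda>l. ?C c (us @ l @ ws)) vs = merge_sum (\<lambda>l. weave (\<lambda>d bs e. f d (bs @ g e l # ws)) us c) vs"
    by (rule merge_sum_cong) (simp add: circ_append us vs ws)
  also have "\<dots> = weave (\<lambda>d bs e. f d (bs @ merge_sum (g e) vs # ws)) us c"
    unfolding weave_merge_sum[symmetric]
    by (rule weave_cong, rule lin_on_merge_sum[symmetric], rule cochain_LA[OF fc]) (use us ws in simp)
  also have "\<dots> = weave (\<lambda>d bs e. - f d (bs @ lead g e vs # ws) - alt (n + 1) (f d (bs @ (g e vs2 * b) # ws))) us c"
  proof (rule weave_cong)
    fix d e and bs :: "'a list" assume "length bs = length us"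
    then have slot: "LA (\<lambda>x. f d (bs @ x # ws))" using us ws by (intro cochain_LA[OF fc]) simp
    show "f d (bs @ merge_sum (g e) vs # ws)
        = - f d (bs @ lead g e vs # ws) - alt (n + 1) (f d (bs @ (g e vs2 * b) # ws))"
      using cocycle_eq[OF g, of vs e] vs
      by (simp add: vs2(1) alt_def lin_on_diff[OF slot] lin_on_minus[OF slot] lin_on_add[OF slot])
  qed
  also have "\<dots> = - ?Y - alt (n + 1) ?Z"
    by (simp only: weave_diff weave_minus weave_alt)
  also have "merge_sum (\<lambda>l. ?C c (us @ vs2 @ l)) (b # ws)
      = merge_sum (\<lambda>l. weave (\<lambda>d bs e. f d (bs @ g e vs2 # l)) us c) (b # ws)"
    by (rule merge_sum_cong) (use ws in \<open>simp add: circ_append us vs2\<close>)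
  also have "\<dots> = ?W" by (simp only: weave_merge_sum)
  finally have merge_part: "merge_sum (?C c) ?as = ?X + alt i (- ?Y - alt (n + 1) ?Z + alt n ?W)" .

  have "?C c (butlast ?as) * last ?as
      = weave (\<lambda>d bs e. f d (bs @ g e vs2 # butlast (b # ws))) us c * last (b # ws)"
    using circ_append[of us i vs2 n "butlast (b # ws)" m f g c] us vs2 ws
    by (simp add: butlast_append del: butlast.simps last.simps)
  also have "\<dots> = ?R"
    by (simp only: LA_weave[OF LA_mult_left])
  finally have last_part: "?C c (butlast ?as) * last ?as = ?R" .

  \<comment> \<open>Weaving \<open>a\<close> as well makes the first term of dg the product of the
    last woven entry with the value of \<open>g\<close>, a merge seen from the left part.\<close>
  have Y: "?Y = weave (\<lambda>d bs e. f d (butlast bs @ (last bs * g e vs1) # ws)) (us @ [a]) c"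
    unfolding weave_snoc
  proof (rule weave_cong)
    fix d e and bs :: "'a list" assume "length bs = length us"
    then have slot: "LA (\<lambda>x. f d (bs @ x # ws))" using us ws by (intro cochain_LA[OF fc]) simp
    show "f d (bs @ lead g e vs # ws) = sweedler sA (\<psi> e a)
        (\<lambda>(x, e'). f d (butlast (bs @ [x]) @ (last (bs @ [x]) * g e' vs1) # ws))"
      by (simp add: lead_def vs1 LA_sweedler[OF slot] case_prod_unfold)
  qed

  have "left_part f g (us @ [a]) vs1 ws c = weave (\<lambda>d bs e. lead f d (bs @ g e vs1 # ws)
      + (merge_sum (\<lambda>l. f d (l @ g e vs1 # ws)) bs
        + alt (i + 1) (f d (butlast bs @ (last bs * g e vs1) # ws)))) (us @ [a]) c"
    unfolding left_part_def
  proof (rule weave_cong)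
    fix d e and bs :: "'a list" assume "length bs = length (us @ [a])"
    \<comment> \<open>\<open>bs\<close> contains the entwined \<open>a\<close>, so the merge of its
      last entry with the inserted value can be split off.\<close>
    then have "bs \<noteq> []" "length bs = i + 1" using us by auto
    then show "lead f d (bs @ g e vs1 # ws) + merge_sum (\<lambda>l. f d (l @ ws)) (bs @ [g e vs1])
      = lead f d (bs @ g e vs1 # ws) + (merge_sum (\<lambda>l. f d (l @ g e vs1 # ws)) bs
        + alt (i + 1) (f d (butlast bs @ (last bs * g e vs1) # ws)))"
      by (simp add: merge_sum_snoc)
  qed
  then have left: "left_part f g (us @ [a]) vs1 ws c = ?L + (?X + alt (i + 1) ?Y)"
    by (simp only: weave_add weave_alt Y)

  have "right_part f g us vs2 (b # ws) c = weave (\<lambda>d bs e.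
      alt i (- f d (bs @ (g e vs2 * b) # ws) - merge_sum (\<lambda>l. f d (bs @ g e vs2 # l)) (b # ws))
      + alt (m + 1) (f d (bs @ g e vs2 # butlast (b # ws)) * last (b # ws))) us c"
    unfolding right_part_def
    by (rule weave_cong) (use us ws in \<open>simp add: butlast_append del: butlast.simps(2) last.simps, simp\<close>)
  also have "\<dots> = alt i (- ?Z - ?W) + alt (m + 1) ?R"
    by (simp only: weave_add weave_alt weave_diff weave_minus)
  finally have right: "right_part f g us vs2 (b # ws) c = alt i (- ?Z - ?W) + alt (m + 1) ?R" .

  have signs: "L + (X + alt i (- Y - alt (n + 1) Z + alt n W)) + alt (m + n) R
      = L + (X + alt (i + 1) Y) + alt (n + 1) (alt i (- Z - W) + alt (m + 1) R)" for L X Y Z W R :: 'a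
    by (cases "even i"; cases "even n"; cases "even m") (simp_all add: alt_def algebra_simps)
  have len: "length ?as = N + 1" and N': "N + 1 = m + n" using us vs ws N by simp_all
  have "differential N ?C c ?as = left_part f g (us @ [a]) vs1 ws c + alt (n + 1) (right_part f g us vs2 (b # ws) c)"
    unfolding differential_eq[OF len] lead_part merge_part last_part N' left right
    by (rule signs)
  moreover have "hd vs = a" "tl vs = vs1" by (simp_all add: vs1(1))
  moreover have "butlast vs = vs2" "last vs = b" by (simp_all add: vs2(1))
  ultimately show ?thesis by (simp only:)
qed

section \<open>Coboundaries and cohomology classes\<close>

lemma lead_add: "lead (\<lambda>c as. f c as + g c as) c as = lead f c as + lead g c as"
  and lead_minus: "lead (\<lambda>c as. - f c as) c as = - lead f c as"
  by (simp_all add: lead_def distrib_left A.sweedler_add A.sweedler_minus case_prod_unfold)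

lemma differential_add:
  "differential n (\<lambda>c as. f c as + g c as) = (\<lambda>c as. differential n f c as + differential n g c as)"
proof (intro ext)
  show "differential n (\<lambda>c as. f c as + g c as) c as = differential n f c as + differential n g c as" for c as
  proof (cases "length as = n + 1")
    case True
    show ?thesis
      unfolding differential_eq[OF True] lead_add merge_sum_add distrib_right alt_add by (simp only: ac_simps)
  qed (simp add: differential_def)
qed

lemma differential_minus: "differential n (\<lambda>c as. - f c as) = (\<lambda>c as. - differential n f c as)"
proof (intro ext)
  show "differential n (\<lambda>c as. - f c as) c as = - differential n f c as" for c as
  proof (cases "length as = n + 1")
    case True
    show ?thesis
      unfolding differential_eq[OF True] lead_minus merge_sum_minus by (simp add: alt_def)
  qed (simp add: differential_def)
qed

lemma cochains_add: "f \<in> cochains n \<Longrightarrow> g \<in> cochains n \<Longrightarrow> (\<lambda>c as. f c as + g c as) \<in> cochains n"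
  and cochains_minus: "f \<in> cochains n \<Longrightarrow> (\<lambda>c as. - f c as) \<in> cochains n"
  and cochains_zero: "(\<lambda>c as. 0) \<in> cochains n"
  by (auto simp: cochains_iff multilin_def lin_on_def A.scale_right_distrib)

lemma coboundaries_zero: "(\<lambda>c as. 0) \<in> coboundaries n"
proof (cases n)
  case (Suc k)
  have "differential k (\<lambda>c as. 0) = (\<lambda>c as. 0)"
    using differential_minus[of k "\<lambda>c as. 0"] differential_add[of k "\<lambda>c as. 0" "\<lambda>c as. 0"]
    by (auto simp: fun_eq_iff)
  then show ?thesis using Suc cochains_zero[of k] by (auto simp: coboundaries_def intro!: image_eqI)
qed (simp add: coboundaries_def)

lemma coboundaries_add:
  "f \<in> coboundaries n \<Longrightarrow> g \<in> coboundaries n \<Longrightarrow> (\<lambda>c as. f c as + g c as) \<in> coboundaries n"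
  by (cases n) (auto simp: coboundaries_def differential_add[symmetric] intro!: imageI cochains_add)

lemma coboundaries_minus: "f \<in> coboundaries n \<Longrightarrow> (\<lambda>c as. - f c as) \<in> coboundaries n"
  by (cases n) (auto simp: coboundaries_def differential_minus[symmetric] intro!: imageI cochains_minus)

lemma coboundaries_alt: "f \<in> coboundaries n \<Longrightarrow> (\<lambda>c as. alt i (f c as)) \<in> coboundaries n"
  by (cases "even i") (simp_all add: alt_def coboundaries_minus)

lemma cocycles_alt: "f \<in> cocycles n \<Longrightarrow> (\<lambda>c as. alt i (f c as)) \<in> cocycles n"
  by (cases "even i") (simp_all add: alt_def cocycles_def cochains_minus differential_minus)

section \<open>Telescoping along the insertion slot\<close>

text \<open>The term \<open>L\<^sub>i\<close> as a cochain.\<close>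
definition left_cochain ::
    "nat \<Rightarrow> nat \<Rightarrow> nat \<Rightarrow> ('c \<Rightarrow> 'a list \<Rightarrow> 'a) \<Rightarrow> ('c \<Rightarrow> 'a list \<Rightarrow> 'a) \<Rightarrow> 'c \<Rightarrow> 'a list \<Rightarrow> 'a" where
  "left_cochain i m n f g c as = (if length as = m + n then
     left_part f g (take i as) (take n (drop i as)) (drop (i + n) as) c else 0)"

lemma left_cochain_append:
  "length us = i \<Longrightarrow> length vs = n \<Longrightarrow> i + length ws = m \<Longrightarrow>
    left_cochain i m n f g c (us @ vs @ ws) = left_part f g us vs ws c"
  by (simp add: left_cochain_def)

text \<open>A primitive is \<open>circ i m n f g\<close>: its differential is L_(i+1) + (-1)^(n+1)
  R_i, and R_i = -L_i.\<close>

lemma left_cochain_Suc: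
  assumes f: "f \<in> cocycles m" and g: "g \<in> cocycles n" and i: "i < m"
  shows "(\<lambda>c as. left_cochain (Suc i) m n f g c as - alt (n + 1) (left_cochain i m n f g c as))
    \<in> coboundaries (m + n)"
proof -
  \<comment> \<open>The degree m + n - 1 of the composition, named without truncated subtraction;
    \<open>i < m\<close> gives \<open>m > 0\<close>.\<close>
  obtain N where N: "Suc N = m + n" using i by (cases m) simp_all
  have "differential N (circ i m n f g) c as
      = left_cochain (Suc i) m n f g c as - alt (n + 1) (left_cochain i m n f g c as)" for c as
  proof (cases "length as = m + n")
    case True
    then have "length as = i + (Suc n + (m - Suc i))" using i by simp
    then obtain us vs ws where as: "as = us @ vs @ ws" "length us = i" "length vs = Suc n" "length ws = m - Suc i"
      by (rule split_list3)
    then have ne: "vs \<noteq> []" by auto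
    have as1: "as = (us @ [hd vs]) @ tl vs @ ws" using as(1) ne by simp
    have as2: "as = us @ butlast vs @ last vs # ws"
      using as(1) append_butlast_last_id[OF ne] by (metis append.assoc append_Cons append_Nil)
    have "left_cochain (Suc i) m n f g c as = left_part f g (us @ [hd vs]) (tl vs) ws c"
      unfolding as1 by (rule left_cochain_append) (use as i in simp_all)
    moreover have "left_cochain i m n f g c as = left_part f g us (butlast vs) (last vs # ws) c"
      unfolding as2 by (rule left_cochain_append) (use as i in simp_all)
    moreover have "differential N (circ i m n f g) c as
        = left_part f g (us @ [hd vs]) (tl vs) ws c + alt (n + 1) (right_part f g us (butlast vs) (last vs # ws) c)"
      unfolding as(1) by (rule differential_circ[OF cocycle_cochain[OF f] g N]) (use as i in simp_all)
    moreover have "right_part f g us (butlast vs) (last vs # ws) c = - left_part f g us (butlast vs) (last vs # ws) c"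
      by (rule right_part_eq[OF f]) (use as i in simp)
    ultimately show ?thesis by (simp only: alt_def) simp
  next
    case False
    then show ?thesis using N by (simp add: differential_def left_cochain_def alt_def)
  qed
  then have "differential N (circ i m n f g)
      = (\<lambda>c as. left_cochain (Suc i) m n f g c as - alt (n + 1) (left_cochain i m n f g c as))"
    by (intro ext)
  moreover have "circ i m n f g \<in> cochains N"
    by (rule circ_cochain[OF cocycle_cochain[OF f] cocycle_cochain[OF g] i N])
  ultimately have "(\<lambda>c as. left_cochain (Suc i) m n f g c as - alt (n + 1) (left_cochain i m n f g c as))
      \<in> differential N ` cochains N"
    by (rule image_eqI[OF sym])
  then show ?thesis by (simp only: coboundaries_def N[symmetric] nat.case)
qed

lemma left_cochain_telescope:
  assumes f: "f \<in> cocycles m" and g: "g \<in> cocycles n"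
  shows "i \<le> m \<Longrightarrow> (\<lambda>c as. left_cochain i m n f g c as - alt (i * (n + 1)) (left_cochain 0 m n f g c as))
    \<in> coboundaries (m + n)"
proof (induction i)
  case 0
  then show ?case by (simp add: alt_def coboundaries_zero)
next
  case (Suc i)
  let ?L = "\<lambda>i. left_cochain i m n f g"
  have "(\<lambda>c as. (?L (Suc i) c as - alt (n + 1) (?L i c as))
      + alt (n + 1) (?L i c as - alt (i * (n + 1)) (?L 0 c as))) \<in> coboundaries (m + n)"
    using Suc by (intro coboundaries_add coboundaries_alt left_cochain_Suc[OF f g]) simp_all
  then show ?case by (simp add: alt_diff alt_alt add.left_commute)
qed

text \<open>With nothing to the left of the inserted value there are no merges; only
  \<open>lead f\<close> remains, on c_(1), with \<open>g\<close> evaluated on c_(2).\<close>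

lemma left_cochain_first:
  assumes "f \<in> cochains m" "g \<in> cochains n"
  shows "left_cochain 0 m n f g = sqcup n m g f"
proof (intro ext)
  show "left_cochain 0 m n f g c as = sqcup n m g f c as" for c as
  proof (cases "length as = n + m")
    case True
    then obtain vs ws where as: "as = vs @ ws" "length vs = n" "length ws = m" by (rule split_list2)
    then show ?thesis
      using left_cochain_append[of "[]" 0 vs n ws m f g c]
      by (simp add: sqcup_append left_part_def weave_def)
  next
    case False
    then show ?thesis by (simp add: left_cochain_def sqcup_def)
  qed
qed

text \<open>With nothing to the right of the inserted value, R_m is the last term of df alone, which
  is (-1)^(m+1) times the cup product; then L_m = -R_m.\<close>

lemma left_cochain_last:
  assumes f: "f \<in> cocycles m"
  shows "left_cochain m m n f g = (\<lambda>c as. alt m (cup m n f g c as))"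
proof (intro ext)
  show "left_cochain m m n f g c as = alt m (cup m n f g c as)" for c as
  proof (cases "length as = m + n")
    case True
    then obtain us vs where as: "as = us @ vs" "length us = m" "length vs = n" by (rule split_list2)
    have "right_part f g us vs [] c = alt (m + 1) (cup m n f g c as)"
      by (simp add: as right_part_def cup_append weave_minus alt_def)
    moreover have "right_part f g us vs [] c = - left_part f g us vs [] c"
      by (rule right_part_eq[OF f]) (simp add: as)
    ultimately show ?thesis
      using left_cochain_append[of us m vs n "[]" m f g c] as
      by (cases "even m") (simp_all add: alt_def neg_eq_iff_add_eq_0 eq_neg_iff_add_eq_0)
  next
    case False
    then show ?thesis by (simp add: left_cochain_def cup_def alt_def)
  qed
qed

lemma cup_cohomologous_sqcup:
  assumes f: "f \<in> cocycles m" and g: "g \<in> cocycles n"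
  shows "(cup m n f g, \<lambda>c as. alt (m * n) (sqcup n m g f c as)) \<in> cohomologous (m + n)"
proof -
  have "(\<lambda>c as. alt m (alt m (cup m n f g c as) - alt (m * (n + 1)) (sqcup n m g f c as))) \<in> coboundaries (m + n)"
    using coboundaries_alt[OF left_cochain_telescope[OF f g order_refl], of m]
    by (simp only: left_cochain_first[OF cocycle_cochain[OF f] cocycle_cochain[OF g]] left_cochain_last[OF f])
  \<comment> \<open>Multiplying by (-1)^m frees the cup product of its sign; the exponents m + m (n
    + 1) and m n have the same parity.\<close>
  moreover have "alt m (alt m x - alt (m * (n + 1)) y) = x - alt (m * n) y" for x y :: 'a
    by (simp add: alt_def)
  moreover have "(\<lambda>c as. alt (m * n) (sqcup n m g f c as)) \<in> cocycles (m + n)"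
    using cocycles_alt[OF sqcup_cocycle[OF g f]] by (simp only: add.commute[of m n])
  ultimately show ?thesis
    by (simp add: cohomologous_def cup_cocycle[OF f g])
qed

section \<open>Passage from cocycles to classes\<close>

lemma cohomologous_refl: "f \<in> cocycles n \<Longrightarrow> (f, f) \<in> cohomologous n"
  by (simp add: cohomologous_def coboundaries_zero)

lemma cohomologous_sym: "(f, g) \<in> cohomologous n \<Longrightarrow> (g, f) \<in> cohomologous n"
  using coboundaries_minus[of "\<lambda>c as. f c as - g c as" n] by (simp add: cohomologous_def)

lemma cohomologous_trans:
  "(f, g) \<in> cohomologous n \<Longrightarrow> (g, h) \<in> cohomologous n \<Longrightarrow> (f, h) \<in> cohomologous n"
  using coboundaries_add[of "\<lambda>c as. f c as - g c as" n "\<lambda>c as. g c as - h c as"]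
  by (simp add: cohomologous_def)

lemma cohomologous_class_eq:
  "(f, g) \<in> cohomologous n \<Longrightarrow> cohomologous n `` {f} = cohomologous n `` {g}"
  by (auto intro: cohomologous_trans cohomologous_sym)

lemma cohomologous_alt:
  "(f, g) \<in> cohomologous n \<Longrightarrow> (\<lambda>c as. alt i (f c as), \<lambda>c as. alt i (g c as)) \<in> cohomologous n"
  using coboundaries_alt[of "\<lambda>c as. f c as - g c as" n i]
  by (simp add: cohomologous_def cocycles_alt alt_diff)

lemma scale_power_minus_one: "sA ((- 1) ^ n) x = alt n x"
  by (induction n) (auto simp: alt_def)

lemma cohomology_cocycle: "\<xi> \<in> cohomology n \<Longrightarrow> f \<in> \<xi> \<Longrightarrow> f \<in> cocycles n"
  by (auto simp: cohomology_def cohomologous_def elim!: quotientE)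

text \<open>Both sides are unions over representatives. Each set united on the right is the class of
  \<open>cup m n f g\<close>, since every \<open>h\<close> cohomologous to
  \<open>sqcup n m g f\<close> is, up to the common sign, cohomologous to it.\<close>

lemma coh_cup_eq_sqcup:
  assumes \<xi>: "\<xi> \<in> cohomology m" and \<eta>: "\<eta> \<in> cohomology n"
  shows "coh_cup m n \<xi> \<eta> = coh_scale (m + n) ((- 1) ^ (m * n)) (coh_sqcup n m \<eta> \<xi>)"
proof -
  let ?s = "\<lambda>h c as. alt (m * n) (h c as)"
  have sq: "(\<Union>h\<in>cohomologous (n + m) `` {sqcup n m g f}. cohomologous (m + n) `` {?s h})
      = cohomologous (m + n) `` {cup m n f g}" if "f \<in> \<xi>" "g \<in> \<eta>" for f g
  proof -
    have f: "f \<in> cocycles m" and g: "g \<in> cocycles n"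
      using that \<xi> \<eta> by (auto intro: cohomology_cocycle)
    have "cohomologous (m + n) `` {?s h} = cohomologous (m + n) `` {cup m n f g}"
      if h: "h \<in> cohomologous (n + m) `` {sqcup n m g f}" for h
    proof -
      have "(sqcup n m g f, h) \<in> cohomologous (m + n)"
        using h by (simp add: add.commute[of m n])
      from cohomologous_trans[OF cup_cohomologous_sqcup[OF f g] cohomologous_alt[OF this]]
      show ?thesis by (rule cohomologous_class_eq[symmetric])
    qed
    \<comment> \<open>The class is nonempty, so the union over \<open>h\<close> is the common class
      and not the empty set.\<close>
    moreover have "sqcup n m g f \<in> cohomologous (n + m) `` {sqcup n m g f}"
      using cohomologous_refl[OF sqcup_cocycle[OF g f]] by simp
    ultimately show ?thesis by auto
  qed
  have "coh_scale (m + n) ((- 1) ^ (m * n)) (coh_sqcup n m \<eta> \<xi>)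
      = (\<Union>g\<in>\<eta>. \<Union>f\<in>\<xi>. \<Union>h\<in>cohomologous (n + m) `` {sqcup n m g f}. cohomologous (m + n) `` {?s h})"
    by (simp add: coh_scale_def coh_sqcup_def scale_power_minus_one)
  also have "\<dots> = (\<Union>g\<in>\<eta>. \<Union>f\<in>\<xi>. cohomologous (m + n) `` {cup m n f g})"
    by (simp add: sq)
  also have "\<dots> = coh_cup m n \<xi> \<eta>"
    unfolding coh_cup_def by blast
  finally show ?thesis by simp
qed

end

theorem theorem4p3:
  fixes sA :: "'k::field \<Rightarrow> 'a::{ring,monoid_mult} \<Rightarrow> 'a"
    and sC :: "'k \<Rightarrow> 'c::ab_group_add \<Rightarrow> 'c"
    and \<Delta> :: "'c \<Rightarrow> ('c \<times> 'c \<Rightarrow>\<^sub>0 'k) set"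
    and \<epsilon> :: "'c \<Rightarrow> 'k"
    and \<psi> :: "'c \<Rightarrow> 'a \<Rightarrow> ('a \<times> 'c \<Rightarrow>\<^sub>0 'k) set"
    and m n :: nat
    and \<xi> \<eta> :: "('c \<Rightarrow> 'a list \<Rightarrow> 'a) set"
  assumes "entwining_structure sA sC \<Delta> \<epsilon> \<psi>"
    and "\<xi> \<in> entwining_structure.cohomology sA sC \<psi> m"
    and "\<eta> \<in> entwining_structure.cohomology sA sC \<psi> n"
  shows "entwining_structure.coh_cup sA sC \<Delta> \<psi> m n \<xi> \<eta> =
    entwining_structure.coh_scale sA sC \<psi> (m + n) ((-1) ^ (m * n))
      (entwining_structure.coh_sqcup sA sC \<Delta> \<psi> n m \<eta> \<xi>)"
  by (rule entwining_structure.coh_cup_eq_sqcup[OF assms])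

end
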